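(* Let $n\ge2$, $\alpha\in\mathbb{R}$, let $u\in\mathscr{D}^n_{0,\alpha}$ be a wave function of $n$ anyons and let $\Omega\subseteq\mathbb{R}^2$ be either a disk or a square, with area $|\Omega|$. Then $$\int_{\Omega^n}\sum_{j=1}^n|D_ju|^2\,dx\ \ge\ (n-1)\,\frac{c_\Omega\,C_{\alpha,n}^2}{|\Omega|}\int_{\Omega^n}|u|^2\,dx,$$ where $c_\Omega$ is a constant (independent of $n$, $\alpha$ and $u$, and depending on $\Omega$ only through whether it is a disk or a square) which satisfies $c_\Omega\ge0.169$ for the disk and $c_\Omega\ge0.112$ for the square, and $$C_{\alpha,n}:=\min_{p=0,1,\ldots,n-2}\ \min_{q\in\mathbb{Z}}|(2p+1)\alpha-2q|.$$
   Context: Points of $\mathbb{R}^{2n}=(\mathbb{R}^2)^n$ are written $x=(\mathbf{x}_1,\ldots,\mathbf{x}_n)$, and $\mathbb{D}:=\{x\in\mathbb{R}^{2n}:\mathbf{x}_j=\mathbf{x}_k\text{ for some }j\ne k\}$. For $0\neq\mathbf{a}\in\mathbb{R}^2$ write $\mathbf{a}^{-1}:=\mathbf{a}/|\mathbf{a}|^2$, and let $\mathbf{a}\mapsto\mathbf{a}I$ denote counter-clockwise rotation by $\pi/2$. For a real statistics parameter $\alpha$ the covariant derivatives are $$D_j:=-i\nabla_{\mathbf{x}_j}+\alpha\sum_{k\ne j}(\mathbf{x}_j-\mathbf{x}_k)^{-1}I,\qquad j=1,\ldots,n.$$ Consider the quadratic form $q(u)=\sum_{j=1}^n\int_{\mathbb{R}^{2n}}|D_ju|^2\,dx$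 on the complex-valued functions in $C_0^\infty(\mathbb{R}^{2n}\setminus\mathbb{D})$ that are totally symmetric under permutations of the $n$ particles. $\mathscr{D}^n_{0,\alpha}$ is the domain of the closure of $q$ in the Hilbert space of totally symmetric functions in $L^2(\mathbb{R}^{2n})$. For $u\in\mathscr{D}^n_{0,\alpha}$, $D_ju\in L^2$ denotes the corresponding $L^2$-limit (equivalently, the distributional expression on $\mathbb{R}^{2n}\setminus\mathbb{D}$). *)

theory Defs
  imports "HOL-Analysis.Analysis" "HOL-Combinatorics.Permutations"
begin

section \<open>Configurations of n particles in the plane\<close>

text \<open>
  A point of \<open>(\<real>\<^sup>2)\<^sup>n\<close> is an element of \<open>{..<n} \<rightarrow>\<^sub>E UNIV\<close>, that is, a function
  \<open>nat \<Rightarrow> real ^ 2\<close> which is \<open>undefined\<close> outside \<open>{..<n}\<close>; the particles are numbered from 0.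
  The particle number is thus an ordinary natural number that can be quantified over.
  Wave functions are total functions on \<open>nat \<Rightarrow> real ^ 2\<close>, but only their values on
  \<open>config n\<close> matter, and updating an entry below \<open>n\<close> does not lead out of \<open>config n\<close>.
\<close>

type_synonym config = "nat \<Rightarrow> real ^ 2"

definition config :: "nat \<Rightarrow> config set" where
  "config n = {..<n} \<rightarrow>\<^sub>E UNIV"

definition config_measure :: "nat \<Rightarrow> config measure" where
  "config_measure n = (\<Pi>\<^sub>M i\<in>{..<n}. lborel)"

definition collisions :: "nat \<Rightarrow> config set" where
  "collisions n = {x \<in> config n. \<exists>j<n. \<exists>k<n. j \<noteq> k \<and> x j = x k}"


section \<open>Smooth functions\<close>

definition partial_deriv ::
    "nat \<Rightarrow> 2 \<Rightarrow> (config \<Rightarrow> complex) \<Rightarrow> config \<Rightarrow> complex" where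
  "partial_deriv j a f x =
     vector_derivative (\<lambda>t. f (x(j := x j + t *\<^sub>R axis a 1))) (at 0)"

fun iterated_deriv ::
    "(nat \<times> 2) list \<Rightarrow> (config \<Rightarrow> complex) \<Rightarrow> config \<Rightarrow> complex" where
  "iterated_deriv [] f = f"
| "iterated_deriv ((j, a) # ds) f = partial_deriv j a (iterated_deriv ds f)"

text \<open>
  Infinitely differentiable: all partial derivatives of all orders exist and are continuous.
  The topology on \<open>nat \<Rightarrow> real ^ 2\<close> is the product topology, which on \<open>config n\<close> is the
  Euclidean one.
\<close>

definition smooth :: "nat \<Rightarrow> (config \<Rightarrow> complex) \<Rightarrow> bool" where
  "smooth n f \<longleftrightarrow>
     (\<forall>ds. set ds \<subseteq> {..<n} \<times> UNIV \<longrightarrow>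
        continuous_on (config n) (iterated_deriv ds f) \<and>
        (\<forall>j<n. \<forall>a. \<forall>x\<in>config n.
           (\<lambda>t. iterated_deriv ds f (x(j := x j + t *\<^sub>R axis a 1))) differentiable (at 0)))"


section \<open>The anyonic quadratic form and its closure\<close>

definition vec_inv :: "real ^ 2 \<Rightarrow> real ^ 2" where
  "vec_inv a = a /\<^sub>R (norm a)\<^sup>2"

definition rot90 :: "real ^ 2 \<Rightarrow> real ^ 2" where
  "rot90 a = vector [- (a $ 2), a $ 1]"

definition cov_deriv ::
    "nat \<Rightarrow> real \<Rightarrow> nat \<Rightarrow> (config \<Rightarrow> complex) \<Rightarrow> config \<Rightarrow> complex ^ 2" where
  "cov_deriv n \<alpha> j f x =
     (\<chi> a. - \<i> * partial_deriv j a f x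
          + of_real ((\<alpha> *\<^sub>R (\<Sum>k\<in>{..<n} - {j}. rot90 (vec_inv (x j - x k)))) $ a) * f x)"

text \<open>
  The symmetric functions in \<open>C\<^sub>0\<^sup>\<infinity>\<close> of the complement of the collision set, extended by zero
  to \<open>config n\<close>.
\<close>

definition form_core :: "nat \<Rightarrow> (config \<Rightarrow> complex) set" where
  "form_core n =
     {f. smooth n f \<and>
         compact (closure {x \<in> config n. f x \<noteq> 0}) \<and>
         closure {x \<in> config n. f x \<noteq> 0} \<subseteq> config n - collisions n \<and>
         (\<forall>\<sigma>. \<sigma> permutes {..<n} \<longrightarrow> (\<forall>x\<in>config n. f (x \<circ> \<sigma>) = f x))}"

definition anyon_form :: "nat \<Rightarrow> real \<Rightarrow> (config \<Rightarrow> complex) \<Rightarrow> ennreal" where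
  "anyon_form n \<alpha> f =
     (\<Sum>j<n. \<integral>\<^sup>+ x. ennreal ((norm (cov_deriv n \<alpha> j f x))\<^sup>2) \<partial>config_measure n)"

definition L2 :: "'a measure \<Rightarrow> ('a \<Rightarrow> 'b::real_normed_vector) set" where
  "L2 M = {f \<in> borel_measurable M. integrable M (\<lambda>x. (norm (f x))\<^sup>2)}"

definition L2_tendsto ::
    "'a measure \<Rightarrow> (nat \<Rightarrow> 'a \<Rightarrow> 'b::real_normed_vector) \<Rightarrow> ('a \<Rightarrow> 'b) \<Rightarrow> bool" where
  "L2_tendsto M f g \<longleftrightarrow> (\<lambda>k. \<integral>\<^sup>+ x. ennreal ((norm (f k x - g x))\<^sup>2) \<partial>M) \<longlonglongrightarrow> 0"

definition L2_sym :: "nat \<Rightarrow> (config \<Rightarrow> complex) set" where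
  "L2_sym n =
     {u \<in> L2 (config_measure n).
        \<forall>\<sigma>. \<sigma> permutes {..<n} \<longrightarrow> (AE x in config_measure n. u (x \<circ> \<sigma>) = u x)}"

text \<open>
  The domain of the closure of the form: limits in the Hilbert space of sequences in the core
  which are Cauchy with respect to the form.
\<close>

definition form_domain :: "nat \<Rightarrow> real \<Rightarrow> (config \<Rightarrow> complex) set" where
  "form_domain n \<alpha> =
     {u \<in> L2_sym n. \<exists>\<phi>. (\<forall>k. \<phi> k \<in> form_core n) \<and> L2_tendsto (config_measure n) \<phi> u \<and>
        (\<forall>\<epsilon>>0. \<exists>N. \<forall>k\<ge>N. \<forall>l\<ge>N. anyon_form n \<alpha> (\<lambda>x. \<phi> k x - \<phi> l x) < ennreal \<epsilon>)}"

text \<open>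
  \<open>Du j\<close> is a representative of the \<open>L\<^sup>2\<close> function \<open>D\<^sub>j u\<close>, the limit of the covariant
  derivatives of an approximating sequence. For \<open>u\<close> in the form domain it exists since
  \<open>L\<^sup>2\<close> is complete, and it is unique almost everywhere since the form is closable.
\<close>

definition is_cov_deriv_limit ::
    "nat \<Rightarrow> real \<Rightarrow> (config \<Rightarrow> complex) \<Rightarrow> (nat \<Rightarrow> config \<Rightarrow> complex ^ 2) \<Rightarrow> bool" where
  "is_cov_deriv_limit n \<alpha> u Du \<longleftrightarrow>
     (\<forall>j<n. Du j \<in> L2 (config_measure n)) \<and>
     (\<exists>\<phi>. (\<forall>k. \<phi> k \<in> form_core n) \<and> L2_tendsto (config_measure n) \<phi> u \<and>
        (\<forall>j<n. L2_tendsto (config_measure n) (\<lambda>k. cov_deriv n \<alpha> j (\<phi> k)) (Du j)))"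


section \<open>Disks, squares and the statistics constant\<close>

definition is_disk :: "(real ^ 2) set \<Rightarrow> bool" where
  "is_disk \<Omega> \<longleftrightarrow> (\<exists>c r. r > 0 \<and> (\<Omega> = ball c r \<or> \<Omega> = cball c r))"

text \<open>Squares may have any orientation: \<open>c\<close> is a corner and \<open>e\<close>, \<open>rot90 e\<close> are the sides there.\<close>

definition is_square :: "(real ^ 2) set \<Rightarrow> bool" where
  "is_square \<Omega> \<longleftrightarrow>
     (\<exists>c e. e \<noteq> 0 \<and>
        (\<Omega> = {c + s *\<^sub>R e + t *\<^sub>R rot90 e | s t. s \<in> {0<..<1} \<and> t \<in> {0<..<1}} \<or>
         \<Omega> = {c + s *\<^sub>R e + t *\<^sub>R rot90 e | s t. s \<in> {0..1} \<and> t \<in> {0..1}}))"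

definition C_stat :: "real \<Rightarrow> nat \<Rightarrow> real" where
  "C_stat \<alpha> n = (MIN p\<in>{0..n - 2}. INF q::int. \<bar>(2 * real p + 1) * \<alpha> - 2 * real_of_int q\<bar>)"

text \<open>The infimum over the integers is a minimum.\<close>

lemma C_stat_INF_attained:
  fixes a :: real
  shows "\<exists>q0::int. (INF q::int. \<bar>a - 2 * real_of_int q\<bar>) = \<bar>a - 2 * real_of_int q0\<bar>"
proof -
  define q0 where "q0 = round (a / 2)"
  have le: "\<bar>a - 2 * real_of_int q0\<bar> \<le> \<bar>a - 2 * real_of_int q\<bar>" for q
    using round_diff_minimal[of "a / 2" q] unfolding q0_def by linarith
  have "(INF q::int. \<bar>a - 2 * real_of_int q\<bar>) = \<bar>a - 2 * real_of_int q0\<bar>"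
  proof (rule antisym)
    show "(INF q::int. \<bar>a - 2 * real_of_int q\<bar>) \<le> \<bar>a - 2 * real_of_int q0\<bar>"
      by (rule cINF_lower) (auto intro!: bdd_belowI[where m = 0])
    show "\<bar>a - 2 * real_of_int q0\<bar> \<le> (INF q::int. \<bar>a - 2 * real_of_int q\<bar>)"
      by (rule cINF_greatest) (auto intro: le)
  qed
  then show ?thesis ..
qed

end

theory Submission
  imports Defs "HOL-Complex_Analysis.Winding_Numbers"
begin

text \<open>
  Since \<open>n \<Sum>\<^sub>j |D\<^sub>j u|\<^sup>2\<close> is at least the sum of \<open>|(D\<^sub>j - D\<^sub>k) u|\<^sup>2\<close> over all pairs, it suffices to treat
  one pair: fix the other particles and the centre of mass \<open>X\<close>, and let \<open>v\<close> be the relative coordinate,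
  \<open>x\<^sub>j = X + v\<close>, \<open>x\<^sub>k = X - v\<close>. Moving \<open>v\<close> halfway around a rectangle centred at the origin exchanges
  the two particles and encloses some number \<open>p \<le> n - 2\<close> of the others, so the gauged wave function
  picks up the phase \<open>\<pi> \<alpha> (2 p + 1)\<close> while \<open>u\<close> itself returns to its value. As
  \<open>|exp (i \<pi> t) - 1| \<ge> 2 dist (t, 2 \<int>)\<close>, this gives \<open>2 C |u| \<le> \<integral> |(D\<^sub>j - D\<^sub>k) u|\<close> along the half loop, for
  the rectangle with corner \<open>v\<close>. For a disk (with axes adapted to \<open>X\<close>) or a square, that rectangle stays
  inside the domain of \<open>v\<close>, and Cauchy-Schwarz and integration over \<open>v\<close> and \<open>X\<close> yield the bound
  on the form core with constants \<open>\<pi> / 4\<close> and \<open>1\<close>.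
\<close>

section \<open>Lebesgue measure on the plane\<close>

text \<open>Rectangles are used because their edges decouple. For the corner \<open>(s, t)\<close>
  the horizontal edge lies on a line that depends on \<open>t\<close> only, the vertical edge on one
  that depends on \<open>s\<close> only. The energy along an edge therefore does not see the other
  coordinate of the corner, and integrating over that coordinate costs a factor
  \<open>2 * M\<close>, where \<open>M\<close> bounds the half-sides. Cauchy-Schwarz along the edge
  costs another \<open>M\<close>, and the passage from pairs to the full form a further 2. The
  outcome is the factor \<open>1 / (4 * M^2)\<close>, so that the constant is the area of
  \<open>\<Omega>\<close> divided by \<open>4 * M^2\<close>. The obstacle is that the potential is
  singular where an edge runs into another particle or its mirror image. Only finitely many values
  of \<open>s\<close> and of \<open>t\<close> are affected, so the bad corners form a null set and
  the phase has to be computed only for edges that avoid all poles. There the potential is the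
  imaginary part of a meromorphic one-form, and the phase is a count of residues.\<close>

lemma nn_integral_lborel_rotate:
  fixes g :: "real \<Rightarrow> real \<Rightarrow> ennreal"
  assumes [measurable]: "case_prod g \<in> borel_measurable (borel \<Otimes>\<^sub>M borel)"
    and unit: "c\<^sup>2 + d\<^sup>2 = 1"
  shows "(\<integral>\<^sup>+s. \<integral>\<^sup>+t. g (c * s - d * t) (d * s + c * t) \<partial>lborel \<partial>lborel) =
         (\<integral>\<^sup>+x. \<integral>\<^sup>+y. g x y \<partial>lborel \<partial>lborel)"
proof (cases "c = 0")
  case True
  then have d: "\<bar>d\<bar> = 1" "d \<noteq> 0"
    using unit by (auto simp: power2_eq_1_iff)
  have "(\<integral>\<^sup>+s. \<integral>\<^sup>+t. g (- (d * t)) (d * s) \<partial>lborel \<partial>lborel) =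
        (\<integral>\<^sup>+s. \<integral>\<^sup>+x. g x (d * s) \<partial>lborel \<partial>lborel)"
    using d by (subst (2) nn_integral_cong[OF nn_integral_real_affine[where c = "-d" and t = 0]]) auto
  also have "\<dots> = (\<integral>\<^sup>+x. \<integral>\<^sup>+s. g x (d * s) \<partial>lborel \<partial>lborel)"
    by (subst lborel_pair.Fubini') auto
  also have "\<dots> = (\<integral>\<^sup>+x. \<integral>\<^sup>+y. g x y \<partial>lborel \<partial>lborel)"
  proof (rule nn_integral_cong)
    fix x
    show "(\<integral>\<^sup>+s. g x (d * s) \<partial>lborel) = (\<integral>\<^sup>+y. g x y \<partial>lborel)"
      using d by (subst nn_integral_real_affine[where c = d and t = 0 and f = "g x"]) auto
  qed
  finally show ?thesis
    using True by simp
next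
  case False
  \<comment> \<open>For \<open>c \<noteq> 0\<close> the rotation splits into two one-variable
    substitutions: \<open>u = c * s - d * t\<close> at fixed \<open>t\<close>, then
    \<open>y = d * u / c + t / c\<close> at fixed \<open>u\<close>. Their Jacobians are
    reciprocal.\<close>
  have eq: "g (c * s - d * t) (d * s + c * t) =
      (\<lambda>u. g u (d * u / c + t / c)) (- (d * t) + c * s)" for s t
  proof -
    have "c * (c * t) + d * (d * t) = t"
      using unit by (metis distrib_right mult.assoc mult_1 power2_eq_square)
    then have "d * s + c * t = d * (- (d * t) + c * s) / c + t / c"
      using False by (simp add: field_simps)
    then show ?thesis
      by (simp add: algebra_simps)
  qed
  have "(\<integral>\<^sup>+s. \<integral>\<^sup>+t. g (c * s - d * t) (d * s + c * t) \<partial>lborel \<partial>lborel) =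
      (\<integral>\<^sup>+t. \<integral>\<^sup>+s. g (c * s - d * t) (d * s + c * t) \<partial>lborel \<partial>lborel)"
    by (subst lborel_pair.Fubini') auto
  also have "\<dots> = (\<integral>\<^sup>+t. ennreal \<bar>1 / c\<bar> * (\<integral>\<^sup>+u. g u (d * u / c + t / c) \<partial>lborel) \<partial>lborel)"
  proof (rule nn_integral_cong)
    fix t
    have [simp]: "ennreal (1 / \<bar>c\<bar>) * (ennreal \<bar>c\<bar> * z) = z" for z
      using False by (simp add: mult.assoc[symmetric] flip: ennreal_mult)
    show "(\<integral>\<^sup>+s. g (c * s - d * t) (d * s + c * t) \<partial>lborel) =
        ennreal \<bar>1 / c\<bar> * (\<integral>\<^sup>+u. g u (d * u / c + t / c) \<partial>lborel)"
      unfolding eq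
      by (subst nn_integral_real_affine[of "\<lambda>u. g u (d * u / c + t / c)" c "- (d * t)"])
        (use False in auto)
  qed
  also have "\<dots> = (\<integral>\<^sup>+u. \<integral>\<^sup>+t. ennreal \<bar>1 / c\<bar> * g u (d * u / c + t / c) \<partial>lborel \<partial>lborel)"
    by (subst lborel_pair.Fubini') (auto simp: nn_integral_cmult)
  also have "\<dots> = (\<integral>\<^sup>+x. \<integral>\<^sup>+y. g x y \<partial>lborel \<partial>lborel)"
  proof (rule nn_integral_cong)
    fix u
    show "(\<integral>\<^sup>+t. ennreal \<bar>1 / c\<bar> * g u (d * u / c + t / c) \<partial>lborel) = (\<integral>\<^sup>+y. g u y \<partial>lborel)"
      by (subst (2) nn_integral_real_affine[of _ "1 / c" "d * u / c"])
        (use False in \<open>auto simp: nn_integral_cmult\<close>)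
  qed
  finally show ?thesis .
qed

text \<open>Makes iterated real integrals available on \<open>real ^ 2\<close>. A measure that gives
  every box its volume is \<open>lborel\<close>, so only boxes are checked.\<close>

lemma lborel_plane: "distr (lborel \<Otimes>\<^sub>M lborel) borel (\<lambda>(s, t). vector [s, t] :: real ^ 2) = lborel"
proof (rule lborel_eqI[symmetric])
  have m: "(\<lambda>(s, t). vector [s, t] :: real ^ 2) \<in> (lborel \<Otimes>\<^sub>M lborel) \<rightarrow>\<^sub>M borel"
  proof -
    have "(\<lambda>p. vector [fst p, snd p] :: real ^ 2) = (\<lambda>p. fst p *\<^sub>R axis 1 1 + snd p *\<^sub>R axis 2 1)"
      by (auto simp: fun_eq_iff vec_eq_iff forall_2 axis_def)
    then show ?thesis
      by (simp add: case_prod_unfold)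
  qed
  fix l u :: "real ^ 2"
  assume le: "\<And>b. b \<in> Basis \<Longrightarrow> l \<bullet> b \<le> u \<bullet> b"
  have le': "l $ 1 \<le> u $ 1" "l $ 2 \<le> u $ 2"
    using le[of "axis 1 1"] le[of "axis 2 1"] by (auto simp: inner_axis axis_in_Basis_iff)
  have "(\<lambda>(s, t). vector [s, t] :: real ^ 2) -` box l u \<inter> space (lborel \<Otimes>\<^sub>M lborel) =
      {l $ 1<..<u $ 1} \<times> {l $ 2<..<u $ 2}"
    by (auto simp: mem_box_cart forall_2 space_pair_measure)
  then have "emeasure (distr (lborel \<Otimes>\<^sub>M lborel) borel (\<lambda>(s, t). vector [s, t] :: real ^ 2)) (box l u)
      = ennreal (u $ 1 - l $ 1) * ennreal (u $ 2 - l $ 2)"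
    using le' by (subst emeasure_distr[OF m]) (auto simp: lborel.emeasure_pair_measure_Times)
  also have "\<dots> = (\<Prod>b\<in>Basis. (u - l) \<bullet> b)"
  proof -
    have B: "(Basis :: (real ^ 2) set) = {axis 1 1, axis 2 1}"
      by (auto simp: Basis_vec_def UNIV_2)
    have "axis 1 1 \<noteq> (axis 2 1 :: real ^ 2)"
      by (simp add: axis_eq_axis)
    then show ?thesis
      unfolding B using le' by (simp add: inner_axis flip: ennreal_mult)
  qed
  finally show "emeasure (distr (lborel \<Otimes>\<^sub>M lborel) borel (\<lambda>(s, t). vector [s, t] :: real ^ 2)) (box l u)
      = (\<Prod>b\<in>Basis. (u - l) \<bullet> b)" .
qed simp

text \<open>The axes in which the relative coordinate is integrated can thus be chosen afresh for
  each centre of mass.\<close>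

lemma nn_integral_plane_frame:
  fixes g :: "real ^ 2 \<Rightarrow> ennreal"
  assumes [measurable]: "g \<in> borel_measurable borel" and e: "norm e = 1"
  shows "(\<integral>\<^sup>+v. g v \<partial>lborel) = (\<integral>\<^sup>+s. \<integral>\<^sup>+t. g (s *\<^sub>R e + t *\<^sub>R rot90 e) \<partial>lborel \<partial>lborel)"
proof -
  have ax: "(vector [s, t] :: real ^ 2) = s *\<^sub>R axis 1 1 + t *\<^sub>R axis 2 1" for s t
    by (auto simp: vec_eq_iff forall_2 axis_def)
  have [measurable]: "(\<lambda>p. vector [fst p, snd p] :: real ^ 2) \<in> borel_measurable (borel \<Otimes>\<^sub>M borel)"
    unfolding ax by measurable
  have unit: "(e $ 1)\<^sup>2 + (e $ 2)\<^sup>2 = 1"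
    using e by (simp add: norm_eq_sqrt_inner inner_vec_def sum_2 power2_eq_square)
  have "(\<integral>\<^sup>+v. g v \<partial>lborel) = (\<integral>\<^sup>+x. \<integral>\<^sup>+y. g (vector [x, y]) \<partial>lborel \<partial>lborel)"
    by (subst lborel_plane[symmetric], subst nn_integral_distr)
      (auto simp: case_prod_unfold lborel.nn_integral_fst[symmetric])
  also have "\<dots> = (\<integral>\<^sup>+s. \<integral>\<^sup>+t. g (vector [e $ 1 * s - e $ 2 * t, e $ 2 * s + e $ 1 * t]) \<partial>lborel \<partial>lborel)"
    by (rule nn_integral_lborel_rotate[OF _ unit, symmetric]) (auto simp: case_prod_unfold)
  also have "\<dots> = (\<integral>\<^sup>+s. \<integral>\<^sup>+t. g (s *\<^sub>R e + t *\<^sub>R rot90 e) \<partial>lborel \<partial>lborel)"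
    by (intro nn_integral_cong arg_cong[where f = g])
      (auto simp: vec_eq_iff forall_2 rot90_def)
  finally show ?thesis .
qed

lemma nn_integral_lborel_affine:
  fixes g :: "'a::euclidean_space \<Rightarrow> ennreal"
  assumes [measurable]: "g \<in> borel_measurable borel" and c: "c \<noteq> 0"
  shows "(\<integral>\<^sup>+v. g v \<partial>lborel) = ennreal (\<bar>c\<bar> ^ DIM('a)) * (\<integral>\<^sup>+v. g (t + c *\<^sub>R v) \<partial>lborel)"
  by (subst lborel_affine[OF c, of t])
    (simp add: nn_integral_density nn_integral_distr nn_integral_cmult)

text \<open>The factor is the Jacobian of \<open>(X, v) \<mapsto> (X + v, X - v)\<close>: stretch by
  \<open>a = b + 2 v\<close> at fixed \<open>b\<close>, then translate by \<open>b = X - v\<close>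
  at fixed \<open>v\<close>.\<close>

lemma nn_integral_centre_of_mass:
  fixes g :: "'a::euclidean_space \<Rightarrow> 'a \<Rightarrow> ennreal"
  assumes [measurable]: "case_prod g \<in> borel_measurable (borel \<Otimes>\<^sub>M borel)"
  shows "(\<integral>\<^sup>+b. \<integral>\<^sup>+a. g a b \<partial>lborel \<partial>lborel) =
    ennreal (2 ^ DIM('a)) * (\<integral>\<^sup>+X. \<integral>\<^sup>+v. g (X + v) (X - v) \<partial>lborel \<partial>lborel)"
proof -
  have "(\<integral>\<^sup>+b. \<integral>\<^sup>+a. g a b \<partial>lborel \<partial>lborel) =
      (\<integral>\<^sup>+b. ennreal (2 ^ DIM('a)) * (\<integral>\<^sup>+v. g (b + 2 *\<^sub>R v) b \<partial>lborel) \<partial>lborel)"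
    by (intro nn_integral_cong, subst nn_integral_lborel_affine[where c = 2]) auto
  also have "\<dots> = ennreal (2 ^ DIM('a)) * (\<integral>\<^sup>+v. \<integral>\<^sup>+b. g (b + 2 *\<^sub>R v) b \<partial>lborel \<partial>lborel)"
    by (subst lborel_pair.Fubini') (auto simp: nn_integral_cmult)
  also have "(\<integral>\<^sup>+v. \<integral>\<^sup>+b. g (b + 2 *\<^sub>R v) b \<partial>lborel \<partial>lborel) =
      (\<integral>\<^sup>+v. \<integral>\<^sup>+X. g (X + v) (X - v) \<partial>lborel \<partial>lborel)"
  proof (rule nn_integral_cong)
    fix v :: 'a
    show "(\<integral>\<^sup>+b. g (b + 2 *\<^sub>R v) b \<partial>lborel) = (\<integral>\<^sup>+X. g (X + v) (X - v) \<partial>lborel)"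
      by (subst nn_integral_lborel_affine[where c = 1 and t = "- v" and g = "\<lambda>b. g (b + 2 *\<^sub>R v) b"])
        (auto intro!: nn_integral_cong simp: algebra_simps scaleR_2)
  qed
  also have "\<dots> = (\<integral>\<^sup>+X. \<integral>\<^sup>+v. g (X + v) (X - v) \<partial>lborel \<partial>lborel)"
    by (subst lborel_pair.Fubini') auto
  finally show ?thesis .
qed

section \<open>Holonomy of the statistics potential\<close>

lemma sin_ge_chord:
  fixes x :: real
  assumes "0 \<le> x" "x \<le> pi / 2"
  shows "2 * x / pi \<le> sin x"
proof -
  have "convex_on {0..pi / 2} (\<lambda>x. - sin x :: real)"
  proof (rule f''_ge0_imp_convex)
    fix x :: real
    assume x: "x \<in> {0..pi / 2}"
    show "((\<lambda>x. - sin x) has_real_derivative - cos x) (at x)"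
      by (auto intro!: derivative_eq_intros)
    show "((\<lambda>x. - cos x) has_real_derivative sin x) (at x)"
      by (auto intro!: derivative_eq_intros)
    show "0 \<le> sin x"
      using x by (intro sin_ge_zero) auto
  qed simp
  \<comment> \<open>The sine is concave here; the chord from 0 to \<open>pi / 2\<close> is evaluated
    at the weight \<open>2 * x / pi\<close>.\<close>
  from convex_onD[OF this, of "2 * x / pi" 0 "pi / 2"] show ?thesis
    using assms by (simp add: field_simps)
qed

lemma abs_sin_ge_of_le:
  fixes x :: real
  assumes "\<bar>x\<bar> \<le> pi / 2"
  shows "2 * \<bar>x\<bar> / pi \<le> \<bar>sin x\<bar>"
proof (cases "0 \<le> x")
  case True
  then show ?thesis
    using sin_ge_chord[of x] assms by linarith
next
  case False
  then show ?thesis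
    using sin_ge_chord[of "- x"] assms by simp
qed

lemma norm_cis_diff_one: "cmod (cis \<theta> - 1) = 2 * \<bar>sin (\<theta> / 2)\<bar>"
proof -
  have "(cmod (cis \<theta> - 1))\<^sup>2 = (cos \<theta> - 1)\<^sup>2 + (sin \<theta>)\<^sup>2"
    by (simp add: cmod_power2)
  also have "\<dots> = 2 - 2 * cos \<theta>"
    using sin_cos_squared_add[of \<theta>] by (simp add: power2_eq_square algebra_simps)
  also have "\<dots> = (2 * \<bar>sin (\<theta> / 2)\<bar>)\<^sup>2"
    using cos_double_sin[of "\<theta> / 2"] by (simp add: power_mult_distrib)
  finally show ?thesis
    by (rule power2_eq_imp_eq) auto
qed

text \<open>The left side is at most twice the distance \<open>|w|\<close> from \<open>t\<close> to
  an even integer with \<open>|w| \<le> 1\<close>. Removing that integer changes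
  \<open>sin (pi * t / 2)\<close> at most in sign, the sine lies above its chord at
  \<open>pi * |w| / 2\<close>, and \<open>|cis \<theta> - 1|\<close> is twice such a sine.\<close>

lemma dist_even_integers_le:
  fixes t :: real
  shows "2 * (INF q::int. \<bar>t - 2 * of_int q\<bar>) \<le> cmod (cis (pi * t) - 1)"
proof -
  define q where "q = round (t / 2)"
  define w where "w = t - 2 * of_int q"
  have w: "\<bar>w\<bar> \<le> 1"
    using of_int_round_abs_le[of "t / 2"] unfolding w_def q_def by linarith
  have "sin (pi * t / 2) = sin (pi * w / 2 + pi * of_int q)"
    by (simp add: w_def field_simps)
  also have "\<dots> = sin (pi * w / 2) * cos (pi * of_int q)"
    by (simp add: sin_add)
  finally have "\<bar>sin (pi * t / 2)\<bar> = \<bar>sin (pi * w / 2)\<bar>"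
    by (simp add: abs_mult)
  moreover have "2 * \<bar>pi * w / 2\<bar> / pi \<le> \<bar>sin (pi * w / 2)\<bar>"
    using w by (intro abs_sin_ge_of_le) (simp add: abs_mult)
  moreover have "2 * \<bar>pi * w / 2\<bar> / pi = \<bar>w\<bar>"
    by (simp add: abs_mult)
  moreover have "(INF q::int. \<bar>t - 2 * of_int q\<bar>) \<le> \<bar>w\<bar>"
    unfolding w_def by (rule cINF_lower) (auto intro!: bdd_belowI[where m = 0])
  ultimately show ?thesis
    by (simp add: norm_cis_diff_one)
qed

text \<open>Here the minimum over \<open>p\<close> enters: a loop of one pair can enclose any number
  of the \<open>n - 2\<close> other particles.\<close>

lemma C_stat_le:
  assumes "p \<le> n - 2"
  shows "2 * C_stat \<alpha> n \<le> cmod (cis (pi * \<alpha> * (2 * real p + 1)) - 1)"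
proof -
  have "C_stat \<alpha> n \<le> (INF q::int. \<bar>(2 * real p + 1) * \<alpha> - 2 * of_int q\<bar>)"
    unfolding C_stat_def using assms by (intro Min_le) auto
  with dist_even_integers_le[of "(2 * real p + 1) * \<alpha>"] show ?thesis
    by (simp add: mult_ac)
qed

lemma C_stat_nonneg: "0 \<le> C_stat \<alpha> n"
  unfolding C_stat_def by (subst Min_ge_iff) (auto intro!: cINF_greatest)

text \<open>The potential is gauged away along the path: after multiplication by the exponential of
  \<open>\<i>\<close> times the primitive of \<open>A\<close>, the derivative of \<open>g\<close>
  has the modulus of the covariant derivative, which then bounds the increment.\<close>

lemma norm_gauge_transport_le:
  fixes g g' :: "real \<Rightarrow> complex" and A :: "real \<Rightarrow> real"
  assumes A: "continuous_on {0..1} A" and g': "continuous_on {0..1} g'"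
    and d: "\<And>\<tau>. \<tau> \<in> {0..1} \<Longrightarrow> (g has_vector_derivative g' \<tau>) (at \<tau> within {0..1})"
  shows "cmod (cis (integral {0..1} A) * g 1 - g 0) \<le>
    integral {0..1} (\<lambda>\<tau>. cmod (- \<i> * g' \<tau> + of_real (A \<tau>) * g \<tau>))"
proof -
  define \<Phi> where "\<Phi> u = integral {0..u} A" for u
  define v where "v u = exp (\<i> * of_real (\<Phi> u)) * g u" for u
  have \<Phi>: "(\<Phi> has_vector_derivative A \<tau>) (at \<tau> within {0..1})" if "\<tau> \<in> {0..1}" for \<tau>
    unfolding \<Phi>_def using integral_has_vector_derivative[OF A that] .
  have ex: "((\<lambda>u. exp (\<i> * of_real (\<Phi> u))) has_vector_derivative
      \<i> * of_real (A \<tau>) * exp (\<i> * of_real (\<Phi> \<tau>))) (at \<tau> within {0..1})" if "\<tau> \<in> {0..1}" for \<tau>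
  proof -
    have "((\<lambda>u. \<i> * of_real (\<Phi> u)) has_vector_derivative \<i> * of_real (A \<tau>)) (at \<tau> within {0..1})"
      using \<Phi>[OF that]
      by (intro has_vector_derivative_mult_right has_vector_derivative_of_real)
        (simp add: has_real_derivative_iff_has_vector_derivative)
    from field_vector_diff_chain_within[OF this, of exp "exp (\<i> * of_real (\<Phi> \<tau>))"]
    show ?thesis
      by (simp add: o_def DERIV_exp has_field_derivative_at_within)
  qed
  have v: "(v has_vector_derivative
      exp (\<i> * of_real (\<Phi> \<tau>)) * (\<i> * (- \<i> * g' \<tau> + of_real (A \<tau>) * g \<tau>))) (at \<tau> within {0..1})"
    if "\<tau> \<in> {0..1}" for \<tau>
    unfolding v_def
    by (rule has_vector_derivative_eq_rhs[OF has_vector_derivative_mult[OF ex[OF that] d[OF that]]])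
      (simp add: algebra_simps)
  have g: "continuous_on {0..1} g"
    using has_vector_derivative_continuous[OF d] by (simp add: continuous_on_eq_continuous_within)
  have c: "continuous_on {0..1} \<Phi>"
    using has_vector_derivative_continuous[OF \<Phi>] by (simp add: continuous_on_eq_continuous_within)
  let ?v' = "\<lambda>\<tau>. exp (\<i> * of_real (\<Phi> \<tau>)) * (\<i> * (- \<i> * g' \<tau> + of_real (A \<tau>) * g \<tau>))"
  have "(?v' has_integral v 1 - v 0) {0..1}"
    using v by (intro fundamental_theorem_of_calculus) auto
  then have "v 1 - v 0 = integral {0..1} ?v'"
    by (simp add: integral_unique)
  also have "cmod \<dots> \<le> integral {0..1} (\<lambda>\<tau>. cmod (- \<i> * g' \<tau> + of_real (A \<tau>) * g \<tau>))"
    by (rule integral_norm_bound_integral)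
      (auto intro!: integrable_continuous_real continuous_intros A g g' c simp: norm_mult)
  finally show ?thesis
    by (simp add: v_def \<Phi>_def cis_conv_exp)
qed

text \<open>Cauchy-Schwarz against the constant 1, obtained as nonnegativity of the
  variance.\<close>

lemma integral_squared_le:
  fixes f :: "real \<Rightarrow> real"
  assumes f: "continuous_on {0..1} f"
  shows "(integral {0..1} f)\<^sup>2 \<le> integral {0..1} (\<lambda>x. (f x)\<^sup>2)"
proof -
  define m where "m = integral {0..1} f"
  have 1: "(\<lambda>x. (f x)\<^sup>2) integrable_on {0..1}" "f integrable_on {0..1}"
    by (auto intro!: integrable_continuous_real continuous_intros f)
  have "0 \<le> integral {0..1} (\<lambda>x. (f x - m)\<^sup>2)"
    by (intro integral_nonneg integrable_continuous_real continuous_intros f) auto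
  also have "(\<lambda>x. (f x - m)\<^sup>2) = (\<lambda>x. (f x)\<^sup>2 - 2 * m * f x + m\<^sup>2)"
    by (auto simp: power2_eq_square algebra_simps)
  also have "integral {0..1} \<dots> = integral {0..1} (\<lambda>x. (f x)\<^sup>2) - 2 * m * m + m\<^sup>2"
  proof (rule integral_unique)
    have "((\<lambda>x. m\<^sup>2) has_integral m\<^sup>2) {0..1::real}"
      using has_integral_const_real[of "m\<^sup>2" 0 1] by simp
    then show "((\<lambda>x. (f x)\<^sup>2 - 2 * m * f x + m\<^sup>2) has_integral
        integral {0..1} (\<lambda>x. (f x)\<^sup>2) - 2 * m * m + m\<^sup>2) {0..1}"
      using 1 by (intro has_integral_add has_integral_diff has_integral_mult_right integrable_integral)
        (auto simp: m_def)
  qed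
  finally show ?thesis
    by (simp add: m_def power2_eq_square)
qed

text \<open>Complex form of the potential of the first particle minus that of the second: the
  imaginary part of \<open>pair_potential I z w * dw\<close> is the statistics one-form in the
  relative coordinate. The pair sits at \<open>w\<close> and \<open>- w\<close>, another particle at
  \<open>z l\<close>, which yields a pole at \<open>z l\<close> from the first particle and one at
  \<open>- z l\<close> from the second. The pole at 0 collects the two halves
  \<open>1 / (2 * w)\<close> of the mutual interaction.\<close>

definition pair_potential :: "nat set \<Rightarrow> (nat \<Rightarrow> complex) \<Rightarrow> complex \<Rightarrow> complex" where
  "pair_potential I z w = 1 / w + (\<Sum>l\<in>I. 1 / (w - z l) + 1 / (w + z l))"

lemma pair_potential_minus: "pair_potential I z (- w) = - pair_potential I z w"
proof -
  have "1 / (- w - z l) + 1 / (- w + z l) = - (1 / (w - z l) + 1 / (w + z l))" for l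
  proof -
    have "1 / (- w - z l) = - (1 / (w + z l))"
      by (metis add.commute minus_add_distrib divide_minus_right uminus_add_conv_diff minus_diff_eq diff_minus_eq_add)
    moreover have "1 / (- w + z l) = - (1 / (w - z l))"
      by (metis divide_minus_right minus_diff_eq uminus_add_conv_diff)
    ultimately show ?thesis
      by simp
  qed
  then show ?thesis
    by (simp add: pair_potential_def sum_negf del: minus_add_distrib)
qed

lemma continuous_on_pair_potential:
  assumes "finite I" "0 \<notin> S" "\<And>l. l \<in> I \<Longrightarrow> z l \<notin> S \<and> - z l \<notin> S"
  shows "continuous_on S (pair_potential I z)"
  unfolding pair_potential_def using assms
  by (intro continuous_intros) (auto simp: add_eq_0_iff2)

text \<open>The sign of the odd integrand cancels that of the reversed increment. Opposite edges of
  a centred rectangle thus contribute equally, and half of the loop carries half of the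
  residues.\<close>

lemma contour_integral_linepath_odd:
  assumes "\<And>w. f (- w) = - f w"
  shows "contour_integral (linepath (- a) (- b)) f = contour_integral (linepath a b) f"
proof -
  have "f (linepath (- a) (- b) x) * (- b - - a) = f (linepath a b x) * (b - a)" for x
    using assms[of "linepath a b x"] by (simp add: linepath_def algebra_simps)
  then show ?thesis
    by (simp add: contour_integral_integral)
qed

text \<open>The full rectangle winds once around 0 and, being symmetric about the origin, encloses
  \<open>z l\<close> and \<open>- z l\<close> together or not at all. With \<open>p\<close> of the
  \<open>z l\<close> inside, the residues give \<open>2 * pi * \<i> * (1 + 2 * p)\<close>; the two
  edges listed are half of the loop.\<close>

lemma contour_integral_pair_potential_quarter:
  fixes s t :: real and z :: "nat \<Rightarrow> complex"
  assumes "finite I" "0 < s" "0 < t"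
    and off: "\<And>l. l \<in> I \<Longrightarrow> \<bar>Re (z l)\<bar> \<noteq> s \<and> \<bar>Im (z l)\<bar> \<noteq> t"
  obtains p where "p \<le> card I"
    "contour_integral (linepath (Complex (-s) (-t)) (Complex s (-t))) (pair_potential I z) +
     contour_integral (linepath (Complex s (-t)) (Complex s t)) (pair_potential I z) =
     \<i> * pi * (2 * real p + 1)"
proof -
  let ?\<kappa> = "pair_potential I z"
  define a where "a = Complex s t"
  define b where "b = Complex s (- t)"
  have corners: "Complex (-s) (-t) = - a" "Complex s (-t) = b" "Complex (-s) t = - b" "Complex s t = a"
    by (auto simp: a_def b_def complex_eq_iff)
  let ?R = "rectpath (- a) a"
  have img: "path_image ?R = cbox (- a) a - box (- a) a"
    using assms by (intro path_image_rectpath_cbox_minus_box) (auto simp: a_def)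
  have ab[simp]: "Re a = s" "Im a = t"
    by (auto simp: a_def)
  have notin: "w \<notin> path_image ?R" if "\<bar>Re w\<bar> \<noteq> s" "\<bar>Im w\<bar> \<noteq> t" for w
    using that unfolding img by (auto simp: in_cbox_complex_iff in_box_complex_iff)
  have wn: "winding_number ?R w = of_bool (w \<in> box (- a) a)" if "\<bar>Re w\<bar> \<noteq> s" "\<bar>Im w\<bar> \<noteq> t" for w
  proof (cases "w \<in> box (- a) a")
    case True
    then show ?thesis
      by (simp add: winding_number_rectpath)
  next
    case False
    moreover have "w \<notin> cbox (- a) a"
      using False that by (auto simp: in_cbox_complex_iff in_box_complex_iff)
    ultimately show ?thesis
      using assms by (simp add: winding_number_rectpath_outside)
  qed
  have hw: "((\<lambda>v. 1 / (v - w)) has_contour_integral 2 * pi * \<i> * of_bool (w \<in> box (- a) a)) ?R"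
    if "\<bar>Re w\<bar> \<noteq> s" "\<bar>Im w\<bar> \<noteq> t" for w
    using has_contour_integral_winding_number[OF _ notin[OF that]] wn[OF that] by auto
  have neg: "- w \<in> box (- a) a \<longleftrightarrow> w \<in> box (- a) a" for w
    by (auto simp: in_box_complex_iff)
  define p where "p = card {l \<in> I. z l \<in> box (- a) a}"
  have "(?\<kappa> has_contour_integral 2 * pi * \<i> +
      (\<Sum>l\<in>I. 2 * pi * \<i> * of_bool (z l \<in> box (- a) a) + 2 * pi * \<i> * of_bool (z l \<in> box (- a) a))) ?R"
    unfolding pair_potential_def[abs_def]
  proof (intro has_contour_integral_add has_contour_integral_sum \<open>finite I\<close>)
    show "((\<lambda>w. 1 / w) has_contour_integral 2 * pi * \<i>) ?R"
      using hw[of 0] assms by (auto simp: in_box_complex_iff)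
    fix l
    assume l: "l \<in> I"
    show "((\<lambda>w. 1 / (w - z l)) has_contour_integral 2 * pi * \<i> * of_bool (z l \<in> box (- a) a)) ?R"
      using off[OF l] by (intro hw) auto
    show "((\<lambda>w. 1 / (w + z l)) has_contour_integral 2 * pi * \<i> * of_bool (z l \<in> box (- a) a)) ?R"
      using hw[of "- z l"] off[OF l] by (simp add: neg)
  qed
  then have "contour_integral ?R ?\<kappa> = 2 * pi * \<i> + 4 * pi * \<i> * (\<Sum>l\<in>I. of_bool (z l \<in> box (- a) a))"
    by (simp add: contour_integral_unique sum.distrib sum_distrib_left mult_ac)
  also have "(\<Sum>l\<in>I. of_bool (z l \<in> box (- a) a)) = (of_nat p :: complex)"
    using \<open>finite I\<close> by (simp add: p_def Int_def of_bool_def sum.If_cases)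
  finally have CI: "contour_integral ?R ?\<kappa> = 2 * (\<i> * pi * (2 * real p + 1))"
    by (simp add: algebra_simps)
  have R: "?R = linepath (- a) b +++ linepath b a +++ linepath a (- b) +++ linepath (- b) (- a)"
    by (simp add: rectpath_def Let_def corners)
  have "continuous_on (path_image ?R) ?\<kappa>"
  proof (rule continuous_on_pair_potential)
    show "0 \<notin> path_image ?R"
      using assms by (intro notin) auto
    show "z l \<notin> path_image ?R \<and> - z l \<notin> path_image ?R" if "l \<in> I" for l
      using off[OF that] by (intro conjI notin) auto
  qed fact
  then have c: "?\<kappa> contour_integrable_on linepath (- a) b" "?\<kappa> contour_integrable_on linepath b a"
    "?\<kappa> contour_integrable_on linepath a (- b)" "?\<kappa> contour_integrable_on linepath (- b) (- a)"
    unfolding R by (auto simp: path_image_join intro!: contour_integrable_continuous_linepath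
        elim!: continuous_on_subset)
  have "contour_integral ?R ?\<kappa> =
      2 * (contour_integral (linepath (- a) b) ?\<kappa> + contour_integral (linepath b a) ?\<kappa>)"
    unfolding R using c contour_integral_linepath_odd[of ?\<kappa> "- a" b, OF pair_potential_minus]
      contour_integral_linepath_odd[of ?\<kappa> b a, OF pair_potential_minus]
    by (simp add: valid_path_join contour_integrable_joinI)
  with CI have "contour_integral (linepath (- a) b) ?\<kappa> + contour_integral (linepath b a) ?\<kappa> =
      \<i> * pi * (2 * real p + 1)"
    by (metis mult_cancel_left zero_neq_numeral)
  moreover have "p \<le> card I"
    unfolding p_def using \<open>finite I\<close> by (intro card_mono) auto
  ultimately show thesis
    using that[of p] unfolding corners by blast
qed

section \<open>The rectangle estimate for the relative motion of a pair\<close>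

text \<open>An axis-parallel segment has one constant coordinate, so the poles are avoided as soon
  as theirs differs from it in modulus.\<close>

lemma continuous_on_pair_potential_segment:
  assumes "finite I"
    and "Im a = Im b \<and> Im a \<noteq> 0 \<and> (\<forall>l\<in>I. \<bar>Im (z l)\<bar> \<noteq> \<bar>Im a\<bar>) \<or>
      Re a = Re b \<and> Re a \<noteq> 0 \<and> (\<forall>l\<in>I. \<bar>Re (z l)\<bar> \<noteq> \<bar>Re a\<bar>)"
  shows "continuous_on (closed_segment a b) (pair_potential I z)"
proof (rule continuous_on_pair_potential[OF assms(1)])
  have seg: "(Im a = Im b \<longrightarrow> Im x = Im a) \<and> (Re a = Re b \<longrightarrow> Re x = Re a)"
    if x: "x \<in> closed_segment a b" for x
  proof -
    obtain u where "x = (1 - u) *\<^sub>R a + u *\<^sub>R b"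
      using x by (auto simp: closed_segment_def)
    then have "Im x = (1 - u) * Im a + u * Im b" "Re x = (1 - u) * Re a + u * Re b"
      by auto
    then show ?thesis
      by (auto simp: algebra_simps)
  qed
  show "0 \<notin> closed_segment a b"
    using seg[of 0] assms(2) by auto
  show "z l \<notin> closed_segment a b \<and> - z l \<notin> closed_segment a b" if "l \<in> I" for l
    using seg[of "z l"] seg[of "- z l"] assms(2) that by fastforce
qed

text \<open>The corner may lie in any quadrant. The half loop that leaves it horizontally runs
  counter-clockwise for \<open>s * t > 0\<close> and clockwise for \<open>s * t < 0\<close>, which
  is what \<open>\<epsilon>\<close> records. The sign is harmless later, since conjugate phases are
  equally far from 1.\<close>

lemma contour_integral_pair_potential_half_turn:
  fixes s t :: real and z :: "nat \<Rightarrow> complex"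
  assumes I: "finite I" "s \<noteq> 0" "t \<noteq> 0"
    and off: "\<And>l. l \<in> I \<Longrightarrow> \<bar>Re (z l)\<bar> \<noteq> \<bar>s\<bar> \<and> \<bar>Im (z l)\<bar> \<noteq> \<bar>t\<bar>"
  obtains p \<epsilon> where "p \<le> card I" "\<epsilon> = 1 \<or> \<epsilon> = -1"
    "contour_integral (linepath (Complex s t) (Complex (-s) t)) (pair_potential I z) +
     contour_integral (linepath (Complex (-s) t) (Complex (-s) (-t))) (pair_potential I z) =
     \<i> * pi * (\<epsilon> * (2 * real p + 1))"
proof -
  let ?\<kappa> = "pair_potential I z"
  obtain p where p: "p \<le> card I"
    "contour_integral (linepath (Complex (-\<bar>s\<bar>) (-\<bar>t\<bar>)) (Complex \<bar>s\<bar> (-\<bar>t\<bar>))) ?\<kappa> +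
     contour_integral (linepath (Complex \<bar>s\<bar> (-\<bar>t\<bar>)) (Complex \<bar>s\<bar> \<bar>t\<bar>)) ?\<kappa> =
     \<i> * pi * (2 * real p + 1)"
    using contour_integral_pair_potential_quarter[of I "\<bar>s\<bar>" "\<bar>t\<bar>" z] assms by auto
  have odd: "contour_integral (linepath (Complex a b) (Complex c d)) ?\<kappa> =
      contour_integral (linepath (Complex (-a) (-b)) (Complex (-c) (-d))) ?\<kappa>" for a b c d
    using contour_integral_linepath_odd[of ?\<kappa> "Complex a b" "Complex c d", OF pair_potential_minus]
    by (simp add: complex_eq_iff Complex_eq)
  have cont_h: "continuous_on (closed_segment (Complex a b) (Complex c b)) ?\<kappa>" if "\<bar>b\<bar> = \<bar>t\<bar>" for a b c
    using I off that by (intro continuous_on_pair_potential_segment) auto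
  have cont_v: "continuous_on (closed_segment (Complex a b) (Complex a d)) ?\<kappa>" if "\<bar>a\<bar> = \<bar>s\<bar>" for a b d
    using I off that by (intro continuous_on_pair_potential_segment) auto
  have rev_h: "contour_integral (linepath (Complex a b) (Complex c b)) ?\<kappa> =
      - contour_integral (linepath (Complex c b) (Complex a b)) ?\<kappa>" if "\<bar>b\<bar> = \<bar>t\<bar>" for a b c
    by (rule contour_integral_reverse_linepath[OF cont_h[OF that]])
  have rev_v: "contour_integral (linepath (Complex a b) (Complex a d)) ?\<kappa> =
      - contour_integral (linepath (Complex a d) (Complex a b)) ?\<kappa>" if "\<bar>a\<bar> = \<bar>s\<bar>" for a b d
    by (rule contour_integral_reverse_linepath[OF cont_v[OF that]])
  consider "s > 0" "t > 0" | "s < 0" "t < 0" | "s > 0" "t < 0" | "s < 0" "t > 0"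
    using I by linarith
  then show thesis
  proof cases
    case 1
    then show thesis
      using p that[of p 1] odd[of s t "-s" t] odd[of "-s" t "-s" "-t"] by simp
  next
    case 2
    then show thesis
      using p that[of p 1] by simp
  next
    case 3
    then show thesis
      using p that[of p "-1"] rev_h[of t s "-s"] rev_v[of "-s" t "-t"] odd[of "-s" "-t" "-s" t]
      by (simp add: algebra_simps)
  next
    case 4
    then show thesis
      using p that[of p "-1"] rev_h[of t s "-s"] rev_v[of "-s" t "-t"] odd[of "-s" t s t]
      by (simp add: algebra_simps)
  qed
qed

text \<open>
  \<open>F\<close> is the wave function in the relative coordinate of one pair, with gradient \<open>(G1, G2)\<close>;
  \<open>P\<close> and \<open>Q\<close> are the components of its covariant gradient.
\<close>

locale relative_motion =
  fixes I :: "nat set" and z :: "nat \<Rightarrow> complex" and \<alpha> :: real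
    and F G1 G2 :: "complex \<Rightarrow> complex"
  assumes finite_I: "finite I"
    and deriv: "\<And>w d. ((\<lambda>\<tau>. F (w + of_real \<tau> * d)) has_vector_derivative
          (of_real (Re d) * G1 w + of_real (Im d) * G2 w)) (at 0)"
    and cont: "continuous_on UNIV F" "continuous_on UNIV G1" "continuous_on UNIV G2"
    and even: "\<And>w. F (- w) = F w"
begin

abbreviation \<kappa> :: "complex \<Rightarrow> complex" where
  "\<kappa> \<equiv> pair_potential I z"

definition P :: "complex \<Rightarrow> complex" where
  "P w = - \<i> * G1 w + of_real (\<alpha> * Im (\<kappa> w)) * F w"

definition Q :: "complex \<Rightarrow> complex" where
  "Q w = - \<i> * G2 w + of_real (\<alpha> * Re (\<kappa> w)) * F w"

lemma measurable_pair_potential [measurable]: "\<kappa> \<in> borel_measurable borel"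
  unfolding pair_potential_def[abs_def] by measurable

lemma measurable_F [measurable]:
  "F \<in> borel_measurable borel" "G1 \<in> borel_measurable borel" "G2 \<in> borel_measurable borel"
  using cont by (auto intro: borel_measurable_continuous_onI)

lemma measurable_PQ [measurable]: "P \<in> borel_measurable borel" "Q \<in> borel_measurable borel"
  unfolding P_def[abs_def] Q_def[abs_def] by measurable

lemma grad_odd: "G1 (- w) = - G1 w" "G2 (- w) = - G2 w"
proof -
  have "((\<lambda>\<tau>. F (w + of_real \<tau> * (- d))) has_vector_derivative
      (of_real (Re d) * G1 (- w) + of_real (Im d) * G2 (- w))) (at 0)" for d
    using deriv[of "- w" d] even[of "w + of_real _ * (- d)"] by simp
  from vector_derivative_unique_at[OF this deriv]
  have *: "of_real (Re d) * G1 (- w) + of_real (Im d) * G2 (- w) =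
      - (of_real (Re d) * G1 w + of_real (Im d) * G2 w)" for d
    by simp
  show "G1 (- w) = - G1 w" "G2 (- w) = - G2 w"
    using *[of 1] *[of \<i>] by auto
qed

text \<open>Allows the edge on the line \<open>Re = - s\<close> to be reflected to
  \<open>Re = s\<close>, so that both edge energies live on lines through the corner.\<close>

lemma cov_grad_odd: "P (- w) = - P w" "Q (- w) = - Q w"
  by (simp_all add: P_def Q_def grad_odd even pair_potential_minus)

text \<open>Along an edge the increment is the constant \<open>b - a\<close>. The covariant
  derivative is then the matching combination of \<open>P\<close> and \<open>Q\<close>, and the
  phase is the imaginary part of a contour integral.\<close>

lemma edge_transport:
  assumes \<kappa>: "continuous_on (closed_segment a b) \<kappa>"
  shows "cmod (cis (\<alpha> * Im (contour_integral (linepath a b) \<kappa>)) * F b - F a) \<le>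
    integral {0..1} (\<lambda>\<tau>. cmod (of_real (Re (b - a)) * P (linepath a b \<tau>) + of_real (Im (b - a)) * Q (linepath a b \<tau>)))"
proof -
  let ?g' = "\<lambda>\<tau>. of_real (Re (b - a)) * G1 (linepath a b \<tau>) + of_real (Im (b - a)) * G2 (linepath a b \<tau>)"
  let ?A = "\<lambda>\<tau>. \<alpha> * Im (\<kappa> (linepath a b \<tau>) * (b - a))"
  have \<kappa>': "continuous_on {0..1} (\<lambda>\<tau>. \<kappa> (linepath a b \<tau>))"
    using continuous_on_compose2[OF \<kappa> continuous_on_linepath[of "{0..1}" a b]] by (simp add: linepath_image_01)
  have "\<kappa> contour_integrable_on linepath a b"
    by (rule contour_integrable_continuous_linepath[OF \<kappa>])
  then have "((\<lambda>\<tau>. \<kappa> (linepath a b \<tau>) * (b - a)) has_integral contour_integral (linepath a b) \<kappa>) {0..1}"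
    using has_contour_integral_integral has_contour_integral_linepath by blast
  then have "(?A has_integral \<alpha> * Im (contour_integral (linepath a b) \<kappa>)) {0..1}"
    using has_integral_Im has_integral_mult_right by blast
  then have A: "integral {0..1} ?A = \<alpha> * Im (contour_integral (linepath a b) \<kappa>)"
    by (rule integral_unique)
  have "cmod (cis (integral {0..1} ?A) * F (linepath a b 1) - F (linepath a b 0)) \<le>
      integral {0..1} (\<lambda>\<tau>. cmod (- \<i> * ?g' \<tau> + of_real (?A \<tau>) * F (linepath a b \<tau>)))"
  proof (rule norm_gauge_transport_le)
    show "continuous_on {0..1} ?A"
      by (intro continuous_intros \<kappa>')
    show "continuous_on {0..1} ?g'"
      by (intro continuous_intros continuous_on_compose2[OF cont(2)] continuous_on_compose2[OF cont(3)]) auto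
    fix \<tau> :: real
    \<comment> \<open>\<open>deriv\<close> speaks of parameter 0 at an arbitrary base point; taking
      the point at parameter \<open>\<tau>\<close> as base and shifting the parameter gives the
      derivative inside the edge.\<close>
    have "((\<lambda>u. u - \<tau>) has_vector_derivative 1) (at \<tau>)"
      by (auto intro!: derivative_eq_intros)
    moreover have "((\<lambda>\<sigma>. F (linepath a b \<tau> + of_real \<sigma> * (b - a))) has_vector_derivative ?g' \<tau>) (at (\<tau> - \<tau>))"
      using deriv[of "linepath a b \<tau>" "b - a"] by simp
    ultimately have "((\<lambda>u. F (linepath a b \<tau> + of_real (u - \<tau>) * (b - a))) has_vector_derivative ?g' \<tau>) (at \<tau>)"
      by (auto dest!: vector_diff_chain_at simp: o_def)
    moreover have "linepath a b \<tau> + of_real (u - \<tau>) * (b - a) = linepath a b u" for u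
      by (simp add: linepath_def scaleR_conv_of_real algebra_simps)
    ultimately show "((\<lambda>u. F (linepath a b u)) has_vector_derivative ?g' \<tau>) (at \<tau> within {0..1})"
      by (simp add: has_vector_derivative_at_within)
  qed
  also have "\<dots> = integral {0..1} (\<lambda>\<tau>. cmod (of_real (Re (b - a)) * P (linepath a b \<tau>) + of_real (Im (b - a)) * Q (linepath a b \<tau>)))"
    by (intro arg_cong[where f = "integral _"] ext arg_cong[where f = cmod])
      (simp add: P_def Q_def algebra_simps)
  finally show ?thesis
    by (simp only: A linepath_1' linepath_0')
qed

text \<open>Cauchy-Schwarz on an edge of length \<open>2 * |a|\<close>, then the substitution
  \<open>x = a - 2 * a * \<tau>\<close>, which maps the unit interval onto the interval from
  \<open>- |a|\<close> to \<open>|a|\<close> for either sign of \<open>a\<close>.\<close>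

lemma edge_energy:
  fixes f :: "real \<Rightarrow> complex"
  assumes [measurable]: "f \<in> borel_measurable borel"
    and f: "continuous_on {0..1} (\<lambda>\<tau>. f (a - 2 * a * \<tau>))" and a: "a \<noteq> 0"
  shows "ennreal ((integral {0..1} (\<lambda>\<tau>. cmod (2 * of_real a * f (a - 2 * a * \<tau>))))\<^sup>2) \<le>
    ennreal (2 * \<bar>a\<bar>) * (\<integral>\<^sup>+x. ennreal ((cmod (f x))\<^sup>2) * indicator {-\<bar>a\<bar>..\<bar>a\<bar>} x \<partial>lborel)"
proof -
  let ?h = "\<lambda>\<tau>. (cmod (f (a - 2 * a * \<tau>)))\<^sup>2"
  have sq: "(cmod (2 * of_real a * y))\<^sup>2 = 4 * a\<^sup>2 * (cmod y)\<^sup>2" for y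
    by (simp add: norm_mult power_mult_distrib)
  have "(integral {0..1} (\<lambda>\<tau>. cmod (2 * of_real a * f (a - 2 * a * \<tau>))))\<^sup>2 \<le>
      integral {0..1} (\<lambda>\<tau>. (cmod (2 * of_real a * f (a - 2 * a * \<tau>)))\<^sup>2)"
    by (intro integral_squared_le continuous_intros f)
  also have "\<dots> = 4 * a\<^sup>2 * integral {0..1} ?h"
    unfolding sq by simp
  finally have 1: "ennreal ((integral {0..1} (\<lambda>\<tau>. cmod (2 * of_real a * f (a - 2 * a * \<tau>))))\<^sup>2) \<le>
      ennreal (4 * a\<^sup>2) * ennreal (integral {0..1} ?h)"
    by (subst ennreal_mult[symmetric]) (auto intro!: ennreal_leI integral_nonneg integrable_continuous_real continuous_intros f)
  have "(?h has_integral integral {0..1} ?h) {0..1}"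
    by (intro integrable_integral integrable_continuous_real continuous_intros f)
  then have "((\<lambda>\<tau>. ?h \<tau> * indicator {0..1} \<tau>) has_integral integral {0..1} ?h) UNIV"
    by (subst (asm) has_integral_restrict_UNIV[symmetric]) (simp add: indicator_def of_bool_def if_distrib cong: if_cong)
  then have 2: "ennreal (integral {0..1} ?h) = (\<integral>\<^sup>+\<tau>. ennreal (?h \<tau> * indicator {0..1} \<tau>) \<partial>lborel)"
    by (intro nn_integral_has_integral_lborel[symmetric]) auto
  have ind: "indicator {-\<bar>a\<bar>..\<bar>a\<bar>} (a - 2 * a * \<tau>) = (indicator {0..1} \<tau> :: real)" for \<tau>
  proof -
    have "a - 2 * a * \<tau> = a * (1 - 2 * \<tau>)"
      by (simp add: algebra_simps)
    then have "- \<bar>a\<bar> \<le> a - 2 * a * \<tau> \<and> a - 2 * a * \<tau> \<le> \<bar>a\<bar> \<longleftrightarrow> \<bar>a\<bar> * \<bar>1 - 2 * \<tau>\<bar> \<le> \<bar>a\<bar> * 1"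
      by (auto simp: abs_mult[symmetric])
    also have "\<dots> \<longleftrightarrow> 0 \<le> \<tau> \<and> \<tau> \<le> 1"
      using a by (subst mult_le_cancel_left_pos) auto
    finally show ?thesis
      by (simp add: indicator_def)
  qed
  have "(\<integral>\<^sup>+x. ennreal ((cmod (f x))\<^sup>2) * indicator {-\<bar>a\<bar>..\<bar>a\<bar>} x \<partial>lborel) =
      (\<integral>\<^sup>+x. ennreal ((cmod (f x))\<^sup>2 * indicator {-\<bar>a\<bar>..\<bar>a\<bar>} x) \<partial>lborel)"
    by (intro nn_integral_cong) (simp add: indicator_def)
  also have "\<dots> = ennreal (2 * \<bar>a\<bar>) * (\<integral>\<^sup>+\<tau>. ennreal (?h \<tau> * indicator {0..1} \<tau>) \<partial>lborel)"
    using a by (subst nn_integral_real_affine[where c = "- (2 * a)" and t = a])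
      (auto simp: ind[symmetric] abs_mult)
  finally have 3: "(\<integral>\<^sup>+x. ennreal ((cmod (f x))\<^sup>2) * indicator {-\<bar>a\<bar>..\<bar>a\<bar>} x \<partial>lborel) =
      ennreal (2 * \<bar>a\<bar>) * ennreal (integral {0..1} ?h)"
    using 2 by simp
  have "ennreal (4 * a\<^sup>2) = ennreal (2 * \<bar>a\<bar>) * ennreal (2 * \<bar>a\<bar>)"
    by (subst ennreal_mult[symmetric]) (auto simp: power2_eq_square)
  then show ?thesis
    using 1 unfolding 3 by (simp add: mult.assoc)
qed

text \<open>After both edges \<open>F\<close> is back at its starting value by evenness, multiplied
  by the phase of the half turn, so \<open>2 * C * |F| \<le> U + V\<close> with \<open>U\<close> and
  \<open>V\<close> the transport defects of the edges. Squaring with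
  \<open>(U + V)^2 \<le> 2 * (U^2 + V^2)\<close> turns the edge lengths \<open>2 * |s|\<close> and
  \<open>2 * |t|\<close> into the factors \<open>|s|\<close> and \<open>|t|\<close>.\<close>

lemma rectangle_bound:
  fixes s t C :: real
  assumes hol: "\<And>p. p \<le> card I \<Longrightarrow> 2 * C \<le> cmod (cis (pi * \<alpha> * (2 * real p + 1)) - 1)"
    and C: "0 \<le> C" and st: "s \<noteq> 0" "t \<noteq> 0"
    and off: "\<And>l. l \<in> I \<Longrightarrow> \<bar>Re (z l)\<bar> \<noteq> \<bar>s\<bar> \<and> \<bar>Im (z l)\<bar> \<noteq> \<bar>t\<bar>"
  shows "ennreal (C\<^sup>2 * (cmod (F (Complex s t)))\<^sup>2) \<le>
    ennreal \<bar>s\<bar> * (\<integral>\<^sup>+x. ennreal ((cmod (P (Complex x t)))\<^sup>2) * indicator {-\<bar>s\<bar>..\<bar>s\<bar>} x \<partial>lborel) +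
    ennreal \<bar>t\<bar> * (\<integral>\<^sup>+y. ennreal ((cmod (Q (Complex s y)))\<^sup>2) * indicator {-\<bar>t\<bar>..\<bar>t\<bar>} y \<partial>lborel)"
proof -
  obtain p \<epsilon> where p: "p \<le> card I" "\<epsilon> = 1 \<or> \<epsilon> = -1"
    and J: "contour_integral (linepath (Complex s t) (Complex (-s) t)) \<kappa> +
     contour_integral (linepath (Complex (-s) t) (Complex (-s) (-t))) \<kappa> =
     \<i> * pi * (\<epsilon> * (2 * real p + 1))"
    by (rule contour_integral_pair_potential_half_turn[OF finite_I st off])
  let ?a = "Complex s t" and ?b = "Complex (-s) t" and ?c = "Complex (-s) (-t)"
  define j1 where "j1 = \<alpha> * Im (contour_integral (linepath ?a ?b) \<kappa>)"
  define j2 where "j2 = \<alpha> * Im (contour_integral (linepath ?b ?c) \<kappa>)"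
  have lp1: "linepath ?a ?b \<tau> = Complex (s - 2 * s * \<tau>) t" for \<tau>
    by (simp add: linepath_def complex_eq_iff algebra_simps)
  have lp2: "linepath ?b ?c \<tau> = - Complex s (- (t - 2 * t * \<tau>))" for \<tau>
    by (simp add: linepath_def complex_eq_iff algebra_simps)
  have \<kappa>1: "continuous_on (closed_segment ?a ?b) \<kappa>" and \<kappa>2: "continuous_on (closed_segment ?b ?c) \<kappa>"
    using st off by (auto intro!: continuous_on_pair_potential_segment finite_I)
  have cont_lp: "continuous_on {0..1} (\<lambda>\<tau>. P (linepath a b \<tau>))" "continuous_on {0..1} (\<lambda>\<tau>. Q (linepath a b \<tau>))"
    if "continuous_on (closed_segment a b) \<kappa>" for a b
  proof -
    have *: "continuous_on (closed_segment a b) P" "continuous_on (closed_segment a b) Q"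
      unfolding P_def[abs_def] Q_def[abs_def]
      by (intro continuous_intros that continuous_on_subset[OF cont(1)]
        continuous_on_subset[OF cont(2)] continuous_on_subset[OF cont(3)]; simp)+
    show "continuous_on {0..1} (\<lambda>\<tau>. P (linepath a b \<tau>))" "continuous_on {0..1} (\<lambda>\<tau>. Q (linepath a b \<tau>))"
      using continuous_on_compose2[OF *(1) continuous_on_linepath[of "{0..1}" a b]]
        continuous_on_compose2[OF *(2) continuous_on_linepath[of "{0..1}" a b]]
      by (auto simp: linepath_image_01)
  qed
  define U where "U = integral {0..1} (\<lambda>\<tau>. cmod (2 * of_real s * P (Complex (s - 2 * s * \<tau>) t)))"
  define V where "V = integral {0..1} (\<lambda>\<tau>. cmod (2 * of_real t * Q (Complex s (- (t - 2 * t * \<tau>)))))"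
  have e1: "cmod (cis j1 * F ?b - F ?a) \<le> U"
    using edge_transport[OF \<kappa>1] unfolding lp1 j1_def U_def by (simp add: norm_mult)
  have e2: "cmod (cis j2 * F ?c - F ?b) \<le> V"
    using edge_transport[OF \<kappa>2] unfolding lp2 j2_def V_def by (simp add: norm_mult cov_grad_odd)
  have "?c = - ?a"
    by (simp add: complex_eq_iff)
  then have Fc: "F ?c = F ?a"
    by (simp add: even)
  have j: "j1 + j2 = \<epsilon> * (pi * \<alpha> * (2 * real p + 1))"
  proof -
    have "j1 + j2 = \<alpha> * Im (contour_integral (linepath ?a ?b) \<kappa> + contour_integral (linepath ?b ?c) \<kappa>)"
      by (simp add: j1_def j2_def algebra_simps)
    then show ?thesis
      unfolding J by simp
  qed
  have "cmod (cis (j1 + j2) - 1) = cmod (cis (pi * \<alpha> * (2 * real p + 1)) - 1)"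
    unfolding j norm_cis_diff_one using p(2) by auto
  then have "2 * C * cmod (F ?a) \<le> cmod (cis (j1 + j2) - 1) * cmod (F ?a)"
    using hol[OF p(1)] by (intro mult_right_mono) auto
  \<comment> \<open>Telescoping through the middle corner \<open>?b\<close>; the unimodular factor
    \<open>cis j1\<close> does not enlarge the second defect.\<close>
  also have "\<dots> = cmod (cis j1 * (cis j2 * F ?c - F ?b) + (cis j1 * F ?b - F ?a))"
    unfolding Fc norm_mult[symmetric] by (simp add: cis_mult[symmetric] algebra_simps)
  also have "\<dots> \<le> V + U"
    using e1 e2 by (intro norm_triangle_le) (simp add: norm_mult)
  finally have "(2 * (C * cmod (F ?a)))\<^sup>2 \<le> (V + U)\<^sup>2"
    using C by (intro power_mono) (auto simp: mult.assoc)
  also have "\<dots> \<le> 2 * (U\<^sup>2 + V\<^sup>2)"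
    using sum_squares_bound[of U V] by (simp add: power2_sum mult_ac)
  finally have main: "C\<^sup>2 * (cmod (F ?a))\<^sup>2 \<le> (U\<^sup>2 + V\<^sup>2) / 2"
    by (simp add: power_mult_distrib)
  have half: "ennreal (x\<^sup>2 / 2) \<le> ennreal \<bar>a\<bar> * Y" if "ennreal (x\<^sup>2) \<le> ennreal (2 * \<bar>a\<bar>) * Y" for x a Y
  proof -
    have "ennreal (x\<^sup>2 / 2) = ennreal (1 / 2) * ennreal (x\<^sup>2)"
      by (subst ennreal_mult[symmetric]) auto
    also have "\<dots> \<le> ennreal (1 / 2) * (ennreal (2 * \<bar>a\<bar>) * Y)"
      by (intro mult_left_mono that) auto
    also have "\<dots> = ennreal \<bar>a\<bar> * Y"
      unfolding mult.assoc[symmetric] by (subst ennreal_mult[symmetric]) auto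
    finally show ?thesis .
  qed
  have U: "ennreal (U\<^sup>2) \<le> ennreal (2 * \<bar>s\<bar>) *
      (\<integral>\<^sup>+x. ennreal ((cmod (P (Complex x t)))\<^sup>2) * indicator {-\<bar>s\<bar>..\<bar>s\<bar>} x \<partial>lborel)"
    unfolding U_def
  proof (rule edge_energy[where f = "\<lambda>x. P (Complex x t)", OF _ _ st(1)])
    show "continuous_on {0..1} (\<lambda>\<tau>. P (Complex (s - 2 * s * \<tau>) t))"
      using cont_lp(1)[OF \<kappa>1] unfolding lp1 .
  qed (simp add: Complex_eq)
  have "ennreal (V\<^sup>2) \<le> ennreal (2 * \<bar>t\<bar>) *
      (\<integral>\<^sup>+y. ennreal ((cmod (Q (Complex s (- y))))\<^sup>2) * indicator {-\<bar>t\<bar>..\<bar>t\<bar>} y \<partial>lborel)"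
    unfolding V_def
  proof (rule edge_energy[where f = "\<lambda>y. Q (Complex s (- y))", OF _ _ st(2)])
    show "continuous_on {0..1} (\<lambda>\<tau>. Q (Complex s (- (t - 2 * t * \<tau>))))"
      using continuous_on_minus[OF cont_lp(2)[OF \<kappa>2]] unfolding lp2 cov_grad_odd by simp
  qed (simp add: Complex_eq)
  \<comment> \<open>Reflecting the vertical edge has reversed its direction; the interval is
    symmetric, so \<open>y \<mapsto> - y\<close> undoes this.\<close>
  also have "(\<integral>\<^sup>+y. ennreal ((cmod (Q (Complex s (- y))))\<^sup>2) * indicator {-\<bar>t\<bar>..\<bar>t\<bar>} y \<partial>lborel) =
      (\<integral>\<^sup>+y. ennreal ((cmod (Q (Complex s y)))\<^sup>2) * indicator {-\<bar>t\<bar>..\<bar>t\<bar>} y \<partial>lborel)"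
    by (subst (2) nn_integral_real_affine[where c = "-1" and t = 0])
      (auto simp: Complex_eq indicator_def intro!: nn_integral_cong)
  finally have V: "ennreal (V\<^sup>2) \<le> ennreal (2 * \<bar>t\<bar>) *
      (\<integral>\<^sup>+y. ennreal ((cmod (Q (Complex s y)))\<^sup>2) * indicator {-\<bar>t\<bar>..\<bar>t\<bar>} y \<partial>lborel)" .
  have "ennreal (C\<^sup>2 * (cmod (F ?a))\<^sup>2) \<le> ennreal (U\<^sup>2 / 2 + V\<^sup>2 / 2)"
    using main by (intro ennreal_leI) (simp add: add_divide_distrib)
  also have "\<dots> = ennreal (U\<^sup>2 / 2) + ennreal (V\<^sup>2 / 2)"
    by (rule ennreal_plus) auto
  also have "\<dots> \<le> ennreal \<bar>s\<bar> * (\<integral>\<^sup>+x. ennreal ((cmod (P (Complex x t)))\<^sup>2) * indicator {-\<bar>s\<bar>..\<bar>s\<bar>} x \<partial>lborel) +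
    ennreal \<bar>t\<bar> * (\<integral>\<^sup>+y. ennreal ((cmod (Q (Complex s y)))\<^sup>2) * indicator {-\<bar>t\<bar>..\<bar>t\<bar>} y \<partial>lborel)"
    by (intro add_mono half U V)
  finally show ?thesis .
qed

text \<open>By \<open>shrink\<close> the edges stay in \<open>L\<close>, so each edge energy is at
  most the energy of the whole section of \<open>L\<close> by the line of the edge. That bound,
  \<open>p t\<close> or \<open>q s\<close>, depends on one coordinate of the corner only;
  integrating over the other one gives \<open>2 * M\<close>, in addition to the \<open>M\<close>
  that bounds \<open>|s|\<close> and \<open>|t|\<close>.\<close>

lemma fiber_inequality:
  assumes hol: "\<And>p. p \<le> card I \<Longrightarrow> 2 * C \<le> cmod (cis (pi * \<alpha> * (2 * real p + 1)) - 1)"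
    and C: "0 \<le> C" and M: "0 \<le> M"
    and [measurable]: "L \<in> sets borel"
    and bounded: "\<And>w. w \<in> L \<Longrightarrow> \<bar>Re w\<bar> \<le> M \<and> \<bar>Im w\<bar> \<le> M"
    and shrink: "\<And>v w. w \<in> L \<Longrightarrow> \<bar>Re v\<bar> \<le> \<bar>Re w\<bar> \<Longrightarrow> \<bar>Im v\<bar> \<le> \<bar>Im w\<bar> \<Longrightarrow> v \<in> L"
  shows "ennreal (C\<^sup>2) * (\<integral>\<^sup>+s. \<integral>\<^sup>+t. ennreal ((cmod (F (Complex s t)))\<^sup>2) * indicator L (Complex s t) \<partial>lborel \<partial>lborel) \<le>
    ennreal (2 * M\<^sup>2) * (\<integral>\<^sup>+s. \<integral>\<^sup>+t. ennreal ((cmod (P (Complex s t)))\<^sup>2 + (cmod (Q (Complex s t)))\<^sup>2) *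
      indicator L (Complex s t) \<partial>lborel \<partial>lborel)"
proof -
  define p where "p t = (\<integral>\<^sup>+x. ennreal ((cmod (P (Complex x t)))\<^sup>2) * indicator L (Complex x t) \<partial>lborel)" for t
  define q where "q s = (\<integral>\<^sup>+y. ennreal ((cmod (Q (Complex s y)))\<^sup>2) * indicator L (Complex s y) \<partial>lborel)" for s
  \<comment> \<open>Keeps the free coordinate of the corner in a bounded interval, without which its
    integral would be infinite.\<close>
  define J where "J x = (indicator {-M..M} x :: ennreal)" for x :: real
  have [measurable]: "(\<lambda>x. Complex (f x) (g x)) \<in> borel_measurable N"
    if "f \<in> borel_measurable N" "g \<in> borel_measurable N" for f g :: "'c \<Rightarrow> real" and N
    using that unfolding Complex_eq by measurable
  have [measurable]: "p \<in> borel_measurable borel" "q \<in> borel_measurable borel" "J \<in> borel_measurable borel"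
    unfolding p_def[abs_def] q_def[abs_def] J_def[abs_def] by measurable
  have J: "(\<integral>\<^sup>+x. J x \<partial>lborel) = ennreal (2 * M)"
    using M by (simp add: J_def[abs_def])
  have fin: "AE x in lborel. x \<notin> S" if "finite S" for S :: "real set"
    using that by (intro AE_not_in finite_imp_null_set_lborel)
  \<comment> \<open>These corners are discarded: an edge line would pass through the origin, another
    particle or its mirror image.\<close>
  have AEs: "AE s in lborel. s \<notin> {0} \<union> (\<lambda>l. Re (z l)) ` I \<union> (\<lambda>l. - Re (z l)) ` I"
    by (rule fin) (simp add: finite_I)
  have AEt: "AE t in lborel. t \<notin> {0} \<union> (\<lambda>l. Im (z l)) ` I \<union> (\<lambda>l. - Im (z l)) ` I"
    by (rule fin) (simp add: finite_I)
  have pw: "ennreal (C\<^sup>2 * (cmod (F (Complex s t)))\<^sup>2) * indicator L (Complex s t) \<le>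
      ennreal M * (p t * J s + q s * J t)"
    if s: "s \<notin> {0} \<union> (\<lambda>l. Re (z l)) ` I \<union> (\<lambda>l. - Re (z l)) ` I"
      and t: "t \<notin> {0} \<union> (\<lambda>l. Im (z l)) ` I \<union> (\<lambda>l. - Im (z l)) ` I" for s t
  proof (cases "Complex s t \<in> L")
    case True
    have st: "\<bar>s\<bar> \<le> M" "\<bar>t\<bar> \<le> M"
      using bounded[OF True] by auto
    have off: "\<bar>Re (z l)\<bar> \<noteq> \<bar>s\<bar> \<and> \<bar>Im (z l)\<bar> \<noteq> \<bar>t\<bar>" if "l \<in> I" for l
      using s t that by (auto simp: abs_if image_iff split: if_splits)
    have "ennreal (C\<^sup>2 * (cmod (F (Complex s t)))\<^sup>2) \<le>
        ennreal \<bar>s\<bar> * (\<integral>\<^sup>+x. ennreal ((cmod (P (Complex x t)))\<^sup>2) * indicator {-\<bar>s\<bar>..\<bar>s\<bar>} x \<partial>lborel) +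
        ennreal \<bar>t\<bar> * (\<integral>\<^sup>+y. ennreal ((cmod (Q (Complex s y)))\<^sup>2) * indicator {-\<bar>t\<bar>..\<bar>t\<bar>} y \<partial>lborel)"
      using s t by (intro rectangle_bound hol C off) auto
    also have "\<dots> \<le> ennreal M * p t + ennreal M * q s"
      unfolding p_def q_def
      by (intro add_mono mult_mono nn_integral_mono ennreal_leI st)
        (auto simp: indicator_def intro: shrink[OF True])
    also have "\<dots> = ennreal M * (p t * J s + q s * J t)"
      using st by (simp add: J_def abs_le_iff distrib_left)
    finally show ?thesis
      using True by simp
  qed simp
  have "ennreal (C\<^sup>2) * (\<integral>\<^sup>+s. \<integral>\<^sup>+t. ennreal ((cmod (F (Complex s t)))\<^sup>2) * indicator L (Complex s t) \<partial>lborel \<partial>lborel) =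
      (\<integral>\<^sup>+s. \<integral>\<^sup>+t. ennreal (C\<^sup>2 * (cmod (F (Complex s t)))\<^sup>2) * indicator L (Complex s t) \<partial>lborel \<partial>lborel)"
    by (simp add: nn_integral_cmult[symmetric] ennreal_mult mult.assoc)
  also have "\<dots> \<le> (\<integral>\<^sup>+s. \<integral>\<^sup>+t. ennreal M * (p t * J s + q s * J t) \<partial>lborel \<partial>lborel)"
    using AEs by (intro nn_integral_mono_AE, elim eventually_mono)
      (use AEt in \<open>intro nn_integral_mono_AE, elim eventually_mono, auto intro!: pw\<close>)
  also have "\<dots> = ennreal M * (ennreal (2 * M) * (\<integral>\<^sup>+t. p t \<partial>lborel) + ennreal (2 * M) * (\<integral>\<^sup>+s. q s \<partial>lborel))"
    by (simp add: nn_integral_cmult nn_integral_add nn_integral_multc J mult.commute)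
  also have "\<dots> = ennreal (2 * M\<^sup>2) * ((\<integral>\<^sup>+t. p t \<partial>lborel) + (\<integral>\<^sup>+s. q s \<partial>lborel))"
  proof -
    have "ennreal (2 * M\<^sup>2) = ennreal M * ennreal (2 * M)"
      using M by (simp add: ennreal_mult[symmetric] power2_eq_square)
    then show ?thesis
      by (simp add: distrib_left mult.assoc)
  qed
  also have "(\<integral>\<^sup>+t. p t \<partial>lborel) =
      (\<integral>\<^sup>+s. \<integral>\<^sup>+t. ennreal ((cmod (P (Complex s t)))\<^sup>2) * indicator L (Complex s t) \<partial>lborel \<partial>lborel)"
    unfolding p_def by (rule lborel_pair.Fubini') measurable
  also have "\<dots> + (\<integral>\<^sup>+s. q s \<partial>lborel) =
      (\<integral>\<^sup>+s. \<integral>\<^sup>+t. ennreal ((cmod (P (Complex s t)))\<^sup>2 + (cmod (Q (Complex s t)))\<^sup>2) *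
        indicator L (Complex s t) \<partial>lborel \<partial>lborel)"
    unfolding q_def by (simp add: nn_integral_add[symmetric] distrib_right)
  finally show ?thesis .
qed

end

section \<open>Smooth wave functions\<close>

lemma smooth_continuous: "smooth n f \<Longrightarrow> continuous_on (config n) f"
  unfolding smooth_def by (drule spec[of _ "[]"]) simp

lemma smooth_partial_continuous:
  assumes "smooth n f" "j < n"
  shows "continuous_on (config n) (partial_deriv j a f)"
  using assms unfolding smooth_def by (auto dest!: spec[of _ "[(j, a)]"])

lemma smooth_has_partial_deriv:
  assumes "smooth n f" "j < n" "x \<in> config n"
  shows "((\<lambda>t. f (x(j := x j + t *\<^sub>R axis a 1))) has_vector_derivative partial_deriv j a f x) (at 0)"
  using assms unfolding smooth_def partial_deriv_def
  by (auto dest!: spec[of _ "[]"] simp: vector_derivative_works)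

lemma has_vector_derivative_translate:
  fixes f :: "real \<Rightarrow> 'a::real_normed_vector"
  assumes "((\<lambda>\<sigma>. f (a + c * \<sigma>)) has_vector_derivative D) (at 0)" "c \<noteq> 0"
  shows "(f has_vector_derivative D /\<^sub>R c) (at a)"
proof -
  have 1: "((\<lambda>u. (u - a) / c) has_vector_derivative 1 / c) (at a)"
    by (auto intro!: derivative_eq_intros)
  have "((\<lambda>\<sigma>. f (a + c * \<sigma>)) has_vector_derivative D) (at ((a - a) / c))"
    using assms by simp
  from vector_diff_chain_at[OF 1 this] show ?thesis
    using assms(2) by (simp add: o_def field_simps)
qed

text \<open>\<open>smooth\<close> supplies only partial derivatives along single coordinates, so the
  derivative along a line is built up one coordinate at a time. In the induction step the new
  coordinate gets its own parameter \<open>w\<close>. Its partial derivative is continuous in both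
  parameters, while differentiability in \<open>u\<close> at the base point is the induction
  hypothesis; this suffices for total differentiability at the origin, and composition with
  \<open>\<tau> \<mapsto> (\<tau>, \<tau>)\<close> finishes.\<close>

lemma smooth_directional_deriv_aux:
  fixes h :: "nat \<times> 2 \<Rightarrow> real"
  assumes f: "smooth n f" and S: "finite S" "S \<subseteq> {..<n} \<times> UNIV" and x: "x \<in> config n"
  shows "((\<lambda>\<tau>. f (\<lambda>i. x i + \<tau> *\<^sub>R (\<Sum>p\<in>S. if fst p = i then h p *\<^sub>R axis (snd p) 1 else 0)))
    has_vector_derivative (\<Sum>p\<in>S. h p *\<^sub>R partial_deriv (fst p) (snd p) f x)) (at 0)"
  using S x
proof (induction S arbitrary: x rule: finite_induct)
  case empty
  then show ?case
    by simp
next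
  case (insert p S)
  obtain j a where p: "p = (j, a)" "j < n"
    using insert.prems by (cases p) auto
  define V where "V i = (\<Sum>p\<in>S. if fst p = i then h p *\<^sub>R axis (snd p) 1 else (0 :: real ^ 2))" for i
  define W where "W i = (if j = i then h p *\<^sub>R axis a 1 else (0 :: real ^ 2))" for i
  define G where "G u w = f (\<lambda>i. x i + u *\<^sub>R V i + w *\<^sub>R W i)" for u w :: real
  have V0: "V i = 0" if "\<not> i < n" for i
    using insert.prems that unfolding V_def by (intro sum.neutral) auto
  have conf: "(\<lambda>i. x i + u *\<^sub>R V i + w *\<^sub>R W i) \<in> config n" for u w
    using insert.prems(2) p V0 by (auto simp: config_def PiE_iff extensional_def W_def)
  have Gw: "(G u has_vector_derivative h p *\<^sub>R partial_deriv j a f (\<lambda>i. x i + u *\<^sub>R V i + w *\<^sub>R W i)) (at w)" for u w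
  \<comment> \<open>A vanishing component cannot be rescaled to unit speed, but then
    \<open>G u\<close> is constant.\<close>
  proof (cases "h p = 0")
    case True
    then have "W i = 0" for i
      by (simp add: W_def)
    then have "G u = (\<lambda>w. f (\<lambda>i. x i + u *\<^sub>R V i))"
      by (intro ext) (simp add: G_def)
    then show ?thesis
      using True by simp
  next
    case False
    let ?y = "\<lambda>i. x i + u *\<^sub>R V i + w *\<^sub>R W i"
    have "?y(j := ?y j + t *\<^sub>R axis a 1) = (\<lambda>i. x i + u *\<^sub>R V i + (w + (1 / h p) * t) *\<^sub>R W i)" for t
      using False by (auto simp: W_def fun_eq_iff algebra_simps)
    then have "((\<lambda>t. G u (w + (1 / h p) * t)) has_vector_derivative partial_deriv j a f ?y) (at 0)"
      using smooth_has_partial_deriv[OF f p(2) conf[of u w], of a] by (simp add: G_def)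
    from has_vector_derivative_translate[OF this] False show ?thesis
      by simp
  qed
  let ?D = "\<lambda>u w. h p *\<^sub>R partial_deriv j a f (\<lambda>i. x i + u *\<^sub>R V i + w *\<^sub>R W i)"
  have "((\<lambda>(u, w). G u w) has_derivative
      (\<lambda>(tu, tw). tu *\<^sub>R (\<Sum>p\<in>S. h p *\<^sub>R partial_deriv (fst p) (snd p) f x) + blinfun_scaleR_left (?D 0 0) tw))
      (at (0, 0) within UNIV \<times> UNIV)"
  proof (rule has_derivative_partialsI[where fy = "\<lambda>u w. blinfun_scaleR_left (?D u w)"])
    show "((\<lambda>u. G u 0) has_derivative (\<lambda>t. t *\<^sub>R (\<Sum>p\<in>S. h p *\<^sub>R partial_deriv (fst p) (snd p) f x))) (at 0)"
      using insert.IH[of x] insert.prems by (simp add: G_def V_def has_vector_derivative_def)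
    show "(G u has_derivative blinfun_apply (blinfun_scaleR_left (?D u w))) (at w)" for u w
      using Gw[of u w] by (simp add: has_vector_derivative_def blinfun_scaleR_left.rep_eq)
    have "continuous_on UNIV (\<lambda>q::real \<times> real. (\<lambda>i. x i + fst q *\<^sub>R V i + snd q *\<^sub>R W i))"
      by (intro continuous_on_coordinatewise_then_product continuous_intros)
    then have "continuous_on UNIV (\<lambda>q::real \<times> real. partial_deriv j a f (\<lambda>i. x i + fst q *\<^sub>R V i + snd q *\<^sub>R W i))"
      using conf by (intro continuous_on_compose2[OF smooth_partial_continuous[OF f p(2)]]) auto
    then have "continuous_on UNIV (\<lambda>q::real \<times> real. blinfun_scaleR_left (?D (fst q) (snd q)))"
      by (intro continuous_intros bounded_linear.continuous_on[OF bounded_linear_blinfun_scaleR_left])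
    then show "continuous (at (0, 0) within UNIV \<times> UNIV) (\<lambda>(u, w). blinfun_scaleR_left (?D u w))"
      by (simp add: continuous_on_eq_continuous_within case_prod_unfold)
  qed auto
  then have "((\<lambda>(u, w). G u w) has_derivative
      (\<lambda>(tu, tw). tu *\<^sub>R (\<Sum>p\<in>S. h p *\<^sub>R partial_deriv (fst p) (snd p) f x) + tw *\<^sub>R ?D 0 0)) (at ((\<lambda>\<tau>. (\<tau>, \<tau>)) 0))"
    by (simp add: blinfun_scaleR_left.rep_eq)
  moreover have "((\<lambda>\<tau>::real. (\<tau>, \<tau>)) has_derivative (\<lambda>t. (t, t))) (at 0)"
    by (auto intro!: derivative_eq_intros)
  ultimately have "((\<lambda>\<tau>. G \<tau> \<tau>) has_derivative (\<lambda>t. t *\<^sub>R (\<Sum>p\<in>S. h p *\<^sub>R partial_deriv (fst p) (snd p) f x) + t *\<^sub>R ?D 0 0)) (at 0)"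
    by (auto dest!: diff_chain_at simp: o_def)
  then have "((\<lambda>\<tau>. G \<tau> \<tau>) has_vector_derivative
      (\<Sum>p\<in>S. h p *\<^sub>R partial_deriv (fst p) (snd p) f x) + ?D 0 0) (at 0)"
    by (simp add: has_vector_derivative_def scaleR_add_right)
  moreover have "G \<tau> \<tau> = f (\<lambda>i. x i + \<tau> *\<^sub>R (\<Sum>p\<in>insert p S. if fst p = i then h p *\<^sub>R axis (snd p) 1 else 0))" for \<tau>
    unfolding G_def V_def W_def using insert.hyps p
    by (intro arg_cong[where f = f] ext) (auto simp: algebra_simps)
  ultimately show ?case
    using insert.hyps by (simp add: p add.commute)
qed

lemma smooth_directional_deriv:
  fixes u w :: "real ^ 2"
  assumes f: "smooth n f" and jk: "j < n" "k < n" "j \<noteq> k" and x: "x \<in> config n"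
  shows "((\<lambda>\<tau>. f (x(j := x j + \<tau> *\<^sub>R u, k := x k + \<tau> *\<^sub>R w))) has_vector_derivative
    (\<Sum>a\<in>UNIV. u $ a *\<^sub>R partial_deriv j a f x + w $ a *\<^sub>R partial_deriv k a f x)) (at 0)"
proof -
  define h where "h p = (if fst p = j then u $ snd p else w $ snd p)" for p :: "nat \<times> 2"
  let ?S = "{j, k} \<times> (UNIV :: 2 set)"
  have vec: "(\<Sum>a\<in>UNIV. v $ a *\<^sub>R axis a 1) = v" for v :: "real ^ 2"
    by (auto simp: vec_eq_iff forall_2 sum_2 axis_def)
  have S: "(\<Sum>p\<in>?S. g p) = (\<Sum>a\<in>UNIV. g (j, a) + g (k, a))" for g :: "nat \<times> 2 \<Rightarrow> 'z::comm_monoid_add"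
  proof -
    have "sum g ?S = (\<Sum>i\<in>{j, k}. \<Sum>a\<in>UNIV. g (i, a))"
      by (subst sum.cartesian_product) (simp add: case_prod_unfold)
    then show ?thesis
      using jk by (simp add: sum.distrib)
  qed
  have "(\<lambda>i. x i + \<tau> *\<^sub>R (\<Sum>p\<in>?S. if fst p = i then h p *\<^sub>R axis (snd p) 1 else 0)) =
      x(j := x j + \<tau> *\<^sub>R u, k := x k + \<tau> *\<^sub>R w)" for \<tau>
    using jk unfolding S by (auto simp: fun_eq_iff h_def sum.distrib vec)
  moreover have "?S \<subseteq> {..<n} \<times> UNIV"
    using jk by auto
  ultimately show ?thesis
    using smooth_directional_deriv_aux[OF f, of ?S x h] jk(3) x unfolding S by (simp add: h_def)
qed

section \<open>The statistics potential in a rotated frame\<close>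

lemma rot90_nth [simp]: "rot90 v $ 1 = - (v $ 2)" "rot90 v $ 2 = v $ 1"
  by (simp_all add: rot90_def)

lemma norm_eq_one_plane: "norm (e :: real ^ 2) = 1 \<Longrightarrow> (e $ 1)\<^sup>2 + (e $ 2)\<^sup>2 = 1"
  by (simp add: norm_eq_sqrt_inner inner_vec_def sum_2 power2_eq_square)

lemma norm_sq_plane: "(norm (v :: real ^ 2))\<^sup>2 = (v $ 1)\<^sup>2 + (v $ 2)\<^sup>2"
  by (simp add: norm_eq_sqrt_inner inner_vec_def sum_2 power2_eq_square)

definition frame :: "real ^ 2 \<Rightarrow> complex \<Rightarrow> real ^ 2" where
  "frame e w = Re w *\<^sub>R e + Im w *\<^sub>R rot90 e"

lemma frame_nth:
  "frame e w $ 1 = Re w * e $ 1 - Im w * e $ 2"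
  "frame e w $ 2 = Re w * e $ 2 + Im w * e $ 1"
  by (simp_all add: frame_def)

lemma frame_linear:
  "frame e (v + w) = frame e v + frame e w" "frame e (v - w) = frame e v - frame e w"
  "frame e (- w) = - frame e w" "frame e (of_real r * w) = r *\<^sub>R frame e w"
  by (simp_all add: frame_def algebra_simps)

lemma norm_frame:
  assumes "norm e = 1"
  shows "norm (frame e w) = cmod w"
proof (rule power2_eq_imp_eq)
  have "(norm (frame e w))\<^sup>2 = ((e $ 1)\<^sup>2 + (e $ 2)\<^sup>2) * ((Re w)\<^sup>2 + (Im w)\<^sup>2)"
    unfolding norm_sq_plane frame_nth by (simp add: power2_eq_square algebra_simps)
  then show "(norm (frame e w))\<^sup>2 = (cmod w)\<^sup>2"
    using norm_eq_one_plane[OF assms] by (simp add: cmod_power2)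
qed auto

lemma frame_surj:
  assumes "norm e = 1"
  shows "frame e (Complex (v \<bullet> e) (v \<bullet> rot90 e)) = v"
proof -
  note u = norm_eq_one_plane[OF assms]
  have "v $ 1 = ((e $ 1)\<^sup>2 + (e $ 2)\<^sup>2) * v $ 1" "v $ 2 = ((e $ 1)\<^sup>2 + (e $ 2)\<^sup>2) * v $ 2"
    unfolding u by simp_all
  then show ?thesis
    by (simp add: vec_eq_iff forall_2 frame_nth inner_vec_def sum_2 power2_eq_square algebra_simps)
qed

text \<open>In the frame of \<open>e\<close> the one-particle potential is \<open>1 / w\<close>, read as \<open>Im (1 / w) ds + Re (1 / w) dt\<close>.\<close>

lemma rot90_vec_inv_frame:
  assumes e: "norm e = 1"
  shows "e $ 1 * rot90 (vec_inv (frame e w)) $ 1 + e $ 2 * rot90 (vec_inv (frame e w)) $ 2 = Im (1 / w)"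
    and "- e $ 2 * rot90 (vec_inv (frame e w)) $ 1 + e $ 1 * rot90 (vec_inv (frame e w)) $ 2 = Re (1 / w)"
proof -
  note u = norm_eq_one_plane[OF e]
  have *: "e $ 1 * rot90 (vec_inv (frame e w)) $ 1 + e $ 2 * rot90 (vec_inv (frame e w)) $ 2 =
      ((e $ 1)\<^sup>2 + (e $ 2)\<^sup>2) * (- Im w / (cmod w)\<^sup>2)"
    "- e $ 2 * rot90 (vec_inv (frame e w)) $ 1 + e $ 1 * rot90 (vec_inv (frame e w)) $ 2 =
      ((e $ 1)\<^sup>2 + (e $ 2)\<^sup>2) * (Re w / (cmod w)\<^sup>2)"
    by (simp_all add: vec_inv_def norm_frame[OF e] frame_nth divide_inverse power2_eq_square algebra_simps)
  show "e $ 1 * rot90 (vec_inv (frame e w)) $ 1 + e $ 2 * rot90 (vec_inv (frame e w)) $ 2 = Im (1 / w)"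
    "- e $ 2 * rot90 (vec_inv (frame e w)) $ 1 + e $ 1 * rot90 (vec_inv (frame e w)) $ 2 = Re (1 / w)"
    unfolding * u by (simp_all add: Im_divide Re_divide cmod_power2)
qed

lemma vec_inv_minus: "vec_inv (- v) = - vec_inv v"
  by (simp add: vec_inv_def)

lemma rot90_minus: "rot90 (- v) = - rot90 v"
  by (simp add: vec_eq_iff forall_2)

lemma vec_inv_double: "vec_inv (2 *\<^sub>R v) = (1 / 2) *\<^sub>R vec_inv v"
  by (simp add: vec_inv_def power_mult_distrib)

lemma rot90_scaleR: "rot90 (c *\<^sub>R v) = c *\<^sub>R rot90 v"
  by (simp add: vec_eq_iff forall_2)

text \<open>The pair is \<open>2 v\<close> apart, so each of the two mutual terms is half of the
  term for \<open>v\<close>; they have opposite signs and the difference restores the whole. For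
  another particle the second particle sees \<open>- (v + (y l - X))\<close>, and oddness of the
  potential turns the difference into a sum.\<close>

lemma relative_potential:
  fixes y :: config and X v :: "real ^ 2"
  assumes jk: "j < n" "k < n" "j \<noteq> k"
  defines "x \<equiv> y(k := X - v, j := X + v)"
  shows "(\<Sum>l\<in>{..<n} - {j}. rot90 (vec_inv (x j - x l))) - (\<Sum>l\<in>{..<n} - {k}. rot90 (vec_inv (x k - x l))) =
    rot90 (vec_inv v) + (\<Sum>l\<in>{..<n} - {j, k}. rot90 (vec_inv (v - (y l - X))) + rot90 (vec_inv (v + (y l - X))))"
proof -
  let ?I = "{..<n} - {j, k}"
  have D: "{..<n} - {j} = insert k ?I" "{..<n} - {k} = insert j ?I"
    using jk by auto
  have half: "rot90 (vec_inv (2 *\<^sub>R v)) = (1 / 2) *\<^sub>R rot90 (vec_inv v)"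
    by (simp only: vec_inv_double rot90_scaleR)
  have jk': "x j - x k = 2 *\<^sub>R v" "x k - x j = - (2 *\<^sub>R v)"
    using jk by (auto simp: x_def scaleR_2)
  have "(\<Sum>l\<in>?I. rot90 (vec_inv (x j - x l))) = (\<Sum>l\<in>?I. rot90 (vec_inv (v - (y l - X))))"
  proof (rule sum.cong)
    fix l
    assume "l \<in> ?I"
    then have "x j - x l = v - (y l - X)"
      using jk by (simp add: x_def)
    then show "rot90 (vec_inv (x j - x l)) = rot90 (vec_inv (v - (y l - X)))"
      by simp
  qed simp
  then have "(\<Sum>l\<in>{..<n} - {j}. rot90 (vec_inv (x j - x l))) =
      (1 / 2) *\<^sub>R rot90 (vec_inv v) + (\<Sum>l\<in>?I. rot90 (vec_inv (v - (y l - X))))"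
    unfolding D by (simp add: jk' half)
  moreover have "(\<Sum>l\<in>?I. rot90 (vec_inv (x k - x l))) = - (\<Sum>l\<in>?I. rot90 (vec_inv (v + (y l - X))))"
    unfolding sum_negf[symmetric]
  proof (rule sum.cong)
    fix l
    assume "l \<in> ?I"
    then have "x k - x l = - (v + (y l - X))"
      using jk by (simp add: x_def)
    then show "rot90 (vec_inv (x k - x l)) = - rot90 (vec_inv (v + (y l - X)))"
      by (simp only: vec_inv_minus rot90_minus)
  qed simp
  then have "(\<Sum>l\<in>{..<n} - {k}. rot90 (vec_inv (x k - x l))) =
      - ((1 / 2) *\<^sub>R rot90 (vec_inv v)) - (\<Sum>l\<in>?I. rot90 (vec_inv (v + (y l - X))))"
    unfolding D using jk by (simp add: jk' half vec_inv_minus rot90_minus)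
  moreover have "(1 / 2) *\<^sub>R r + (1 / 2) *\<^sub>R r = r" for r :: "real ^ 2"
    by (simp flip: scaleR_add_left)
  ultimately show ?thesis
    by (simp add: sum.distrib algebra_simps)
qed

text \<open>The bridge to the residue count: in the frame each vector summand becomes the imaginary
  and real part of a simple pole.\<close>

lemma relative_potential_frame:
  fixes w :: complex
  assumes e: "norm e = 1" and y: "\<And>l. l \<in> I \<Longrightarrow> y l = frame e (z l)"
  defines "A \<equiv> rot90 (vec_inv (frame e w)) + (\<Sum>l\<in>I. rot90 (vec_inv (frame e w - y l)) + rot90 (vec_inv (frame e w + y l)))"
  shows "e $ 1 * A $ 1 + e $ 2 * A $ 2 = Im (pair_potential I z w)"
    and "- e $ 2 * A $ 1 + e $ 1 * A $ 2 = Re (pair_potential I z w)"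
proof -
  have A: "A = rot90 (vec_inv (frame e w)) +
      (\<Sum>l\<in>I. rot90 (vec_inv (frame e (w - z l))) + rot90 (vec_inv (frame e (w + z l))))"
    unfolding A_def using y by (simp add: frame_linear)
  have 1: "c * A $ a = c * rot90 (vec_inv (frame e w)) $ a +
      (\<Sum>l\<in>I. c * rot90 (vec_inv (frame e (w - z l))) $ a + c * rot90 (vec_inv (frame e (w + z l))) $ a)" for c a
    unfolding A by (simp add: sum_distrib_left distrib_left)
  show "e $ 1 * A $ 1 + e $ 2 * A $ 2 = Im (pair_potential I z w)"
    unfolding 1 pair_potential_def plus_complex.simps Im_sum rot90_vec_inv_frame(1)[OF e, symmetric]
    by (simp add: sum.distrib algebra_simps del: rot90_nth)
  show "- e $ 2 * A $ 1 + e $ 1 * A $ 2 = Re (pair_potential I z w)"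
    unfolding 1 pair_potential_def plus_complex.simps Re_sum rot90_vec_inv_frame(2)[OF e, symmetric]
    by (simp add: sum.distrib sum_subtractf sum_negf algebra_simps del: rot90_nth)
qed

text \<open>The change of frame is a real orthogonal matrix, hence unitary on
  \<open>complex ^ 2\<close>.\<close>

lemma norm_sq_frame_components:
  fixes Z :: "complex ^ 2" and e :: "real ^ 2"
  assumes "norm e = 1"
  shows "(cmod (of_real (e $ 1) * Z $ 1 + of_real (e $ 2) * Z $ 2))\<^sup>2 +
    (cmod (- of_real (e $ 2) * Z $ 1 + of_real (e $ 1) * Z $ 2))\<^sup>2 = (norm Z)\<^sup>2"
proof -
  have "(norm Z)\<^sup>2 = (cmod (Z $ 1))\<^sup>2 + (cmod (Z $ 2))\<^sup>2"
    by (simp add: norm_vec_def L2_set_def sum_2)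
  also have "\<dots> = ((e $ 1)\<^sup>2 + (e $ 2)\<^sup>2) * ((cmod (Z $ 1))\<^sup>2 + (cmod (Z $ 2))\<^sup>2)"
    by (simp add: norm_eq_one_plane[OF assms])
  also have "\<dots> = (cmod (of_real (e $ 1) * Z $ 1 + of_real (e $ 2) * Z $ 2))\<^sup>2 +
    (cmod (- of_real (e $ 2) * Z $ 1 + of_real (e $ 1) * Z $ 2))\<^sup>2"
    unfolding cmod_power2 by (simp add: power2_eq_square algebra_simps)
  finally show ?thesis ..
qed

section \<open>Fibers with fixed centre of mass\<close>

definition symmetric :: "nat \<Rightarrow> (config \<Rightarrow> complex) \<Rightarrow> bool" where
  "symmetric n f \<longleftrightarrow> (\<forall>\<sigma>. \<sigma> permutes {..<n} \<longrightarrow> (\<forall>x\<in>config n. f (x \<circ> \<sigma>) = f x))"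

lemma symmetric_swap:
  assumes "symmetric n f" "j < n" "k < n" "j \<noteq> k" "x \<in> config n"
  shows "f (x(j := x k, k := x j)) = f x"
proof -
  have "Transposition.transpose j k permutes {..<n}"
    using assms by (intro permutes_swap_id) auto
  moreover have "x \<circ> Transposition.transpose j k = x(j := x k, k := x j)"
    using assms(4) by (auto simp: fun_eq_iff Transposition.transpose_def)
  ultimately show ?thesis
    using assms unfolding symmetric_def by metis
qed

text \<open>What the rectangle argument asks of a domain: for each centre \<open>X\<close> there are
  axes in which the rectangle spanned by an allowed relative position stays allowed.
  \<open>M\<close> bounds its half-sides. Only \<open>X + frame e v\<close> is required, because
  \<open>- v\<close> satisfies the same hypotheses and yields the other particle.\<close>

definition admissible :: "real \<Rightarrow> (real ^ 2) set \<Rightarrow> bool" where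
  "admissible M \<Omega> \<longleftrightarrow> 0 \<le> M \<and> \<Omega> \<in> sets borel \<and>
    (\<forall>X. \<exists>e. norm e = 1 \<and> (\<forall>w. X + frame e w \<in> \<Omega> \<longrightarrow> X - frame e w \<in> \<Omega> \<longrightarrow>
       \<bar>Re w\<bar> \<le> M \<and> \<bar>Im w\<bar> \<le> M \<and>
       (\<forall>v. \<bar>Re v\<bar> \<le> \<bar>Re w\<bar> \<longrightarrow> \<bar>Im v\<bar> \<le> \<bar>Im w\<bar> \<longrightarrow> X + frame e v \<in> \<Omega>)))"

locale pair_fiber =
  fixes n j k :: nat and \<alpha> :: real and f :: "config \<Rightarrow> complex" and y :: config and X e :: "real ^ 2"
  assumes smooth: "smooth n f" and sym: "symmetric n f"
    and jk: "j < n" "k < n" "j \<noteq> k"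
    and y: "y \<in> ({..<n} - {j, k}) \<rightarrow>\<^sub>E UNIV"
    and e: "norm e = 1"
begin

definition conf :: "complex \<Rightarrow> config" where
  "conf w = y(k := X - frame e w, j := X + frame e w)"

abbreviation grad :: "complex \<Rightarrow> 2 \<Rightarrow> complex" where
  "grad w a \<equiv> partial_deriv j a f (conf w) - partial_deriv k a f (conf w)"

definition G1 :: "complex \<Rightarrow> complex" where
  "G1 w = of_real (e $ 1) * grad w 1 + of_real (e $ 2) * grad w 2"

definition G2 :: "complex \<Rightarrow> complex" where
  "G2 w = - of_real (e $ 2) * grad w 1 + of_real (e $ 1) * grad w 2"

definition z :: "nat \<Rightarrow> complex" where
  "z l = Complex ((y l - X) \<bullet> e) ((y l - X) \<bullet> rot90 e)"

lemma conf: "conf w \<in> config n"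
  using y jk by (auto simp: conf_def config_def PiE_iff extensional_def)

lemma continuous_conf: "continuous_on UNIV conf"
  unfolding conf_def[abs_def] frame_def fun_upd_def
proof (rule continuous_on_coordinatewise_then_product)
  show "continuous_on UNIV (\<lambda>w. if i = j then X + (Re w *\<^sub>R e + Im w *\<^sub>R rot90 e)
      else if i = k then X - (Re w *\<^sub>R e + Im w *\<^sub>R rot90 e) else y i)" for i
    by (cases "i = j"; cases "i = k") (auto intro!: continuous_intros)
qed

text \<open>Evenness is the exchange symmetry, as \<open>conf (- w)\<close> is \<open>conf w\<close>
  with particles \<open>j\<close> and \<open>k\<close> swapped. The gradient is a difference of two
  partial gradients because the two particles move in opposite directions.\<close>

sublocale relative_motion "{..<n} - {j, k}" z \<alpha> "\<lambda>w. f (conf w)" G1 G2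
proof
  show "finite ({..<n} - {j, k})"
    by simp
  show "f (conf (- w)) = f (conf w)" for w
  proof -
    have "conf (- w) = (conf w)(j := conf w k, k := conf w j)"
      using jk by (auto simp: conf_def frame_linear fun_eq_iff)
    then show ?thesis
      using symmetric_swap[OF sym jk conf] by simp
  qed
  show "continuous_on UNIV (\<lambda>w. f (conf w))"
    using conf by (intro continuous_on_compose2[OF smooth_continuous[OF smooth] continuous_conf]) auto
  have "continuous_on UNIV (\<lambda>w. partial_deriv i a f (conf w))" if "i < n" for i a
    using conf by (intro continuous_on_compose2[OF smooth_partial_continuous[OF smooth that] continuous_conf]) auto
  then show "continuous_on UNIV G1" "continuous_on UNIV G2"
    unfolding G1_def[abs_def] G2_def[abs_def] using jk by (auto intro!: continuous_intros)
  fix w d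
  have "conf (w + of_real \<tau> * d) =
      (conf w)(j := conf w j + \<tau> *\<^sub>R frame e d, k := conf w k + \<tau> *\<^sub>R (- frame e d))" for \<tau>
    using jk by (auto simp: conf_def frame_linear fun_eq_iff)
  moreover have "(\<Sum>a\<in>UNIV. frame e d $ a *\<^sub>R partial_deriv j a f (conf w) +
      (- frame e d) $ a *\<^sub>R partial_deriv k a f (conf w)) = of_real (Re d) * G1 w + of_real (Im d) * G2 w"
    by (simp add: sum_2 frame_nth G1_def G2_def scaleR_conv_of_real algebra_simps)
  ultimately show "((\<lambda>\<tau>. f (conf (w + of_real \<tau> * d))) has_vector_derivative
      of_real (Re d) * G1 w + of_real (Im d) * G2 w) (at 0)"
    using smooth_directional_deriv[OF smooth jk conf[of w], of "frame e d" "- frame e d"] by simp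
qed

text \<open>\<open>P\<close> and \<open>Q\<close> are the components of the difference of the two
  covariant derivatives along \<open>e\<close> and \<open>rot90 e\<close>, and a rotation preserves
  the norm.\<close>

lemma norm_relative_cov_deriv:
  "(cmod (P w))\<^sup>2 + (cmod (Q w))\<^sup>2 =
    (norm (cov_deriv n \<alpha> j f (conf w) - cov_deriv n \<alpha> k f (conf w)))\<^sup>2"
proof -
  let ?I = "{..<n} - {j, k}"
  define Z where "Z = cov_deriv n \<alpha> j f (conf w) - cov_deriv n \<alpha> k f (conf w)"
  define A where "A = rot90 (vec_inv (frame e w)) +
    (\<Sum>l\<in>?I. rot90 (vec_inv (frame e w - (y l - X))) + rot90 (vec_inv (frame e w + (y l - X))))"
  have z: "y l - X = frame e (z l)" for l
    unfolding z_def frame_surj[OF e] ..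
  have A: "e $ 1 * A $ 1 + e $ 2 * A $ 2 = Im (pair_potential ?I z w)"
    "- e $ 2 * A $ 1 + e $ 1 * A $ 2 = Re (pair_potential ?I z w)"
    unfolding A_def by (rule relative_potential_frame[OF e z])+
  have Z: "Z $ a = - \<i> * grad w a + of_real (\<alpha> * A $ a) * f (conf w)" for a
  proof -
    have "(\<Sum>l\<in>{..<n} - {j}. rot90 (vec_inv (conf w j - conf w l))) - (\<Sum>l\<in>{..<n} - {k}. rot90 (vec_inv (conf w k - conf w l))) = A"
      unfolding conf_def A_def by (rule relative_potential[OF jk])
    then have "(\<Sum>l\<in>{..<n} - {j}. rot90 (vec_inv (conf w j - conf w l))) = A + (\<Sum>l\<in>{..<n} - {k}. rot90 (vec_inv (conf w k - conf w l)))"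
      by (simp add: algebra_simps)
    then show ?thesis
      by (simp add: Z_def cov_deriv_def algebra_simps)
  qed
  have "of_real (e $ 1) * Z $ 1 + of_real (e $ 2) * Z $ 2 =
      - \<i> * G1 w + of_real (\<alpha> * (e $ 1 * A $ 1 + e $ 2 * A $ 2)) * f (conf w)"
    "- of_real (e $ 2) * Z $ 1 + of_real (e $ 1) * Z $ 2 =
      - \<i> * G2 w + of_real (\<alpha> * (- e $ 2 * A $ 1 + e $ 1 * A $ 2)) * f (conf w)"
    unfolding Z by (simp_all add: G1_def G2_def algebra_simps)
  then have PQ: "P w = of_real (e $ 1) * Z $ 1 + of_real (e $ 2) * Z $ 2"
    "Q w = - of_real (e $ 2) * Z $ 1 + of_real (e $ 1) * Z $ 2"
    unfolding A P_def Q_def by simp_all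
  show ?thesis
    unfolding PQ Z_def[symmetric] by (rule norm_sq_frame_components[OF e])
qed

end

section \<open>Integration over all configurations\<close>

lemma space_config_measure [simp]: "space (config_measure n) = config n"
  by (simp add: config_measure_def config_def space_PiM)

text \<open>Continuity refers to the topology of all of \<open>nat \<Rightarrow> real ^ 2\<close>,
  the measure to a finite product; this connects them. The coordinates from \<open>n\<close> on are
  constantly \<open>undefined\<close> and thus measurable.\<close>

lemma measurable_config_inclusion: "(\<lambda>x. x) \<in> config_measure n \<rightarrow>\<^sub>M (borel :: config measure)"
proof -
  have "(\<lambda>x. x) \<in> config_measure n \<rightarrow>\<^sub>M Pi\<^sub>M UNIV (\<lambda>i::nat. borel :: (real ^ 2) measure)"
  proof (rule measurable_PiM_single')
    fix i :: nat
    show "(\<lambda>x. x i) \<in> config_measure n \<rightarrow>\<^sub>M (borel :: (real ^ 2) measure)"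
    proof (cases "i < n")
      case True
      then have "(\<lambda>x. x i) \<in> config_measure n \<rightarrow>\<^sub>M (lborel :: (real ^ 2) measure)"
        unfolding config_measure_def by (intro measurable_component_singleton) auto
      then show ?thesis
        by simp
    next
      case False
      then have "(\<lambda>x. undefined) \<in> config_measure n \<rightarrow>\<^sub>M (borel :: (real ^ 2) measure) \<longleftrightarrow>
          (\<lambda>x. x i) \<in> config_measure n \<rightarrow>\<^sub>M (borel :: (real ^ 2) measure)"
        by (intro measurable_cong) (simp add: config_def PiE_iff extensional_def)
      then show ?thesis
        by simp
    qed
  qed auto
  then show ?thesis
    using measurable_cong_sets[OF refl sets_PiM_equal_borel] by blast
qed

lemma measurable_config_coordinate [measurable]:
  "(\<lambda>x. x i) \<in> config_measure n \<rightarrow>\<^sub>M (borel :: (real ^ 2) measure)"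
  using measurable_compose[OF measurable_config_inclusion
      borel_measurable_continuous_onI[OF continuous_on_product_coordinates]] .

lemma measurable_config_continuous:
  assumes "continuous_on (config n) f"
  shows "f \<in> borel_measurable (config_measure n)"
proof -
  have "(\<lambda>x. x) \<in> config_measure n \<rightarrow>\<^sub>M restrict_space borel (config n)"
    by (intro measurable_restrict_space2 measurable_config_inclusion) auto
  from measurable_compose[OF this borel_measurable_continuous_on_restrict[OF assms]] show ?thesis .
qed

lemma measurable_vec:
  fixes f :: "'a \<Rightarrow> 'b::euclidean_space ^ 'n"
  assumes "\<And>i. (\<lambda>x. f x $ i) \<in> borel_measurable M"
  shows "f \<in> borel_measurable M"
  using assms by (subst borel_measurable_euclidean_space) (auto simp: Basis_vec_def inner_axis)

lemma measurable_rot90 [measurable]: "rot90 \<in> borel_measurable borel"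
proof (rule measurable_vec)
  have "(\<lambda>x. - x $ 2) \<in> borel_measurable (borel :: (real ^ 2) measure)"
    "(\<lambda>x. x $ 1) \<in> borel_measurable (borel :: (real ^ 2) measure)"
    by (auto intro!: borel_measurable_continuous_onI continuous_intros)
  then show "(\<lambda>x. rot90 x $ i) \<in> borel_measurable borel" for i
    using exhaust_2[of i] by auto
qed

lemma measurable_vec_inv [measurable]: "vec_inv \<in> borel_measurable borel"
  unfolding vec_inv_def[abs_def] by measurable

lemma measurable_cov_deriv:
  assumes "smooth n f" "j < n"
  shows "cov_deriv n \<alpha> j f \<in> borel_measurable (config_measure n)"
proof (rule measurable_vec)
  fix a :: 2
  have [measurable]: "f \<in> borel_measurable (config_measure n)"
    "partial_deriv j a f \<in> borel_measurable (config_measure n)"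
    by (rule measurable_config_continuous smooth_continuous[OF assms(1)] smooth_partial_continuous[OF assms])+
  have [measurable]: "(\<lambda>v. v $ a) \<in> borel_measurable (borel :: (real ^ 2) measure)"
    by (auto intro!: borel_measurable_continuous_onI continuous_intros)
  have "(\<lambda>x. cov_deriv n \<alpha> j f x $ a) = (\<lambda>x. - \<i> * partial_deriv j a f x +
      of_real ((\<alpha> *\<^sub>R (\<Sum>k\<in>{..<n} - {j}. rot90 (vec_inv (x j - x k)))) $ a) * f x)"
    by (simp add: cov_deriv_def)
  also have "\<dots> \<in> borel_measurable (config_measure n)"
    by measurable
  finally show "(\<lambda>x. cov_deriv n \<alpha> j f x $ a) \<in> borel_measurable (config_measure n)" .
qed

text \<open>Fubini with the coordinates \<open>j\<close> and \<open>k\<close> split off and replaced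
  by centre of mass and relative coordinate. The factor 4 is the Jacobian in the plane and occurs on
  both sides of the pair estimate.\<close>

lemma nn_integral_config_pair:
  assumes jk: "j < n" "k < n" "j \<noteq> k" and g: "g \<in> borel_measurable (config_measure n)"
  shows "(\<integral>\<^sup>+x. g x \<partial>config_measure n) = (\<integral>\<^sup>+y. 4 * (\<integral>\<^sup>+X. \<integral>\<^sup>+v. g (y(k := X - v, j := X + v)) \<partial>lborel \<partial>lborel)
    \<partial>Pi\<^sub>M ({..<n} - {j, k}) (\<lambda>_. lborel))"
proof -
  let ?I = "{..<n} - {j, k}"
  interpret product_sigma_finite "\<lambda>_::nat. lborel :: (real ^ 2) measure"
    by standard
  have I: "{..<n} = insert j (insert k ?I)"
    using jk by auto
  have g1: "g \<in> borel_measurable (Pi\<^sub>M (insert j (insert k ?I)) (\<lambda>_. lborel))"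
    using g unfolding config_measure_def I[symmetric] .
  have "(\<integral>\<^sup>+x. g x \<partial>config_measure n) = (\<integral>\<^sup>+x. g x \<partial>Pi\<^sub>M (insert j (insert k ?I)) (\<lambda>_. lborel))"
    unfolding config_measure_def I[symmetric] ..
  also have "\<dots> = (\<integral>\<^sup>+x. \<integral>\<^sup>+a. g (x(j := a)) \<partial>lborel \<partial>Pi\<^sub>M (insert k ?I) (\<lambda>_. lborel))"
    using jk by (intro product_nn_integral_insert g1) auto
  also have "\<dots> = (\<integral>\<^sup>+y. \<integral>\<^sup>+b. \<integral>\<^sup>+a. g (y(k := b, j := a)) \<partial>lborel \<partial>lborel \<partial>Pi\<^sub>M ?I (\<lambda>_. lborel))"
  proof (rule product_nn_integral_insert)
    have [measurable]: "g \<in> borel_measurable (Pi\<^sub>M (insert j (insert k ?I)) (\<lambda>_. lborel))"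
      by (rule g1)
    show "(\<lambda>x. \<integral>\<^sup>+a. g (x(j := a)) \<partial>lborel) \<in> borel_measurable (Pi\<^sub>M (insert k ?I) (\<lambda>_. lborel))"
      by measurable
  qed auto
  also have "\<dots> = (\<integral>\<^sup>+y. 4 * (\<integral>\<^sup>+X. \<integral>\<^sup>+v. g (y(k := X - v, j := X + v)) \<partial>lborel \<partial>lborel)
    \<partial>Pi\<^sub>M ?I (\<lambda>_. lborel))"
  proof (rule nn_integral_cong)
    fix y :: config
    assume y: "y \<in> space (Pi\<^sub>M ?I (\<lambda>_. lborel))"
    have "(\<lambda>(a, b). y(k := b, j := a)) \<in> borel \<Otimes>\<^sub>M borel \<rightarrow>\<^sub>M Pi\<^sub>M (insert j (insert k ?I)) (\<lambda>_. lborel :: (real ^ 2) measure)"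
    proof (rule measurable_PiM_single')
      show "(\<lambda>x. (case x of (a, b) \<Rightarrow> y(k := b, j := a)) i) \<in> borel \<Otimes>\<^sub>M borel \<rightarrow>\<^sub>M (lborel :: (real ^ 2) measure)" for i
        using jk by (cases "i = j"; cases "i = k") (auto simp: case_prod_unfold)
      show "(\<lambda>x. case x of (a, b) \<Rightarrow> y(k := b, j := a)) \<in> space (borel \<Otimes>\<^sub>M borel) \<rightarrow>
          (\<Pi>\<^sub>E i\<in>insert j (insert k ?I). space (lborel :: (real ^ 2) measure))"
        using y by (auto simp: space_PiM PiE_iff extensional_def)
    qed
    from measurable_compose[OF this g1]
    have "(\<lambda>(a, b). g (y(k := b, j := a))) \<in> borel_measurable (borel \<Otimes>\<^sub>M borel)"
      by (simp add: case_prod_unfold)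
    from nn_integral_centre_of_mass[OF this]
    show "(\<integral>\<^sup>+b. \<integral>\<^sup>+a. g (y(k := b, j := a)) \<partial>lborel \<partial>lborel) =
        4 * (\<integral>\<^sup>+X. \<integral>\<^sup>+v. g (y(k := X - v, j := X + v)) \<partial>lborel \<partial>lborel)"
      by simp
  qed
  finally show ?thesis .
qed

lemma measurable_conf_const:
  assumes "y \<in> ({..<n} - {j, k}) \<rightarrow>\<^sub>E UNIV" "j < n" "k < n" "j \<noteq> k"
  shows "(\<lambda>v. y(k := X - v, j := X + v)) \<in> (borel :: (real ^ 2) measure) \<rightarrow>\<^sub>M config_measure n"
  unfolding config_measure_def
proof (rule measurable_PiM_single')
  show "(\<lambda>v. (y(k := X - v, j := X + v)) i) \<in> borel \<rightarrow>\<^sub>M (lborel :: (real ^ 2) measure)" for i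
    using assms by (cases "i = j"; cases "i = k") auto
  show "(\<lambda>v. y(k := X - v, j := X + v)) \<in> space borel \<rightarrow> (\<Pi>\<^sub>E i\<in>{..<n}. space (lborel :: (real ^ 2) measure))"
    using assms by (auto simp: space_PiM PiE_iff extensional_def)
qed

lemma continuous_on_frame: "continuous_on S (frame e)"
  unfolding frame_def[abs_def] by (intro continuous_intros)

lemma (in pair_fiber) fiber_bound:
  assumes \<Omega>: "\<Omega> \<in> sets borel" "0 \<le> M"
    and adm: "\<And>w. X + frame e w \<in> \<Omega> \<Longrightarrow> X - frame e w \<in> \<Omega> \<Longrightarrow>
       \<bar>Re w\<bar> \<le> M \<and> \<bar>Im w\<bar> \<le> M \<and>
       (\<forall>v. \<bar>Re v\<bar> \<le> \<bar>Re w\<bar> \<longrightarrow> \<bar>Im v\<bar> \<le> \<bar>Im w\<bar> \<longrightarrow> X + frame e v \<in> \<Omega>)"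
  defines "E \<equiv> {..<n} \<rightarrow>\<^sub>E \<Omega>"
  shows "(\<integral>\<^sup>+v. ennreal ((C_stat \<alpha> n)\<^sup>2) * (ennreal ((cmod (f (y(k := X - v, j := X + v))))\<^sup>2) *
      indicator E (y(k := X - v, j := X + v))) \<partial>lborel) \<le>
    (\<integral>\<^sup>+v. ennreal (2 * M\<^sup>2) * (ennreal ((norm (cov_deriv n \<alpha> j f (y(k := X - v, j := X + v)) -
      cov_deriv n \<alpha> k f (y(k := X - v, j := X + v))))\<^sup>2) *
      indicator E (y(k := X - v, j := X + v))) \<partial>lborel)"
proof -
  have [measurable]: "(\<lambda>v. y(k := X - v, j := X + v)) \<in> (borel :: (real ^ 2) measure) \<rightarrow>\<^sub>M config_measure n"
    by (rule measurable_conf_const[OF y jk])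
  have [measurable]: "f \<in> borel_measurable (config_measure n)"
    by (intro measurable_config_continuous smooth_continuous smooth)
  have [measurable]: "cov_deriv n \<alpha> j f \<in> borel_measurable (config_measure n)"
    "cov_deriv n \<alpha> k f \<in> borel_measurable (config_measure n)"
    by (intro measurable_cov_deriv smooth jk)+
  have [measurable]: "E \<in> sets (config_measure n)"
    unfolding E_def config_measure_def using \<Omega> by (intro sets_PiM_I_finite) auto
  define L where "L = {w. X + frame e w \<in> \<Omega> \<and> X - frame e w \<in> \<Omega>}"
  have [measurable]: "frame e \<in> borel_measurable borel"
    by (intro borel_measurable_continuous_onI continuous_on_frame)
  have L: "L \<in> sets borel"
    unfolding L_def using \<Omega> by measurable
  have conf_eq: "y(k := X - frame e w, j := X + frame e w) = conf w" for w
    by (simp add: conf_def)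
  define c where "c = (indicator (({..<n} - {j, k}) \<rightarrow>\<^sub>E \<Omega>) y :: ennreal)"
  have ind: "(indicator E (conf w) :: ennreal) = c * indicator L w" for w
    using jk y unfolding E_def c_def L_def conf_def
    by (auto simp: indicator_def PiE_iff extensional_def)
  have fr: "s *\<^sub>R e + t *\<^sub>R rot90 e = frame e (Complex s t)" for s t
    by (simp add: frame_def)
  have c: "card ({..<n} - {j, k}) = n - 2"
    using jk by (subst card_Diff_subset) auto
  have [measurable]: "conf \<in> borel \<rightarrow>\<^sub>M config_measure n"
  proof -
    have "(\<lambda>w. y(k := X - frame e w, j := X + frame e w)) \<in> borel \<rightarrow>\<^sub>M config_measure n"
      by (rule measurable_compose[OF _ measurable_conf_const[OF y jk]]) measurable
    then show ?thesis
      by (simp add: conf_def[abs_def])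
  qed
  have [measurable]: "(\<lambda>x. Complex (g x) (h x)) \<in> borel_measurable N"
    if "g \<in> borel_measurable N" "h \<in> borel_measurable N" for g h :: "'c \<Rightarrow> real" and N
    using that unfolding Complex_eq by measurable
  have fib: "ennreal ((C_stat \<alpha> n)\<^sup>2) *
      (\<integral>\<^sup>+s. \<integral>\<^sup>+t. ennreal ((cmod (f (conf (Complex s t))))\<^sup>2) * indicator L (Complex s t) \<partial>lborel \<partial>lborel) \<le>
    ennreal (2 * M\<^sup>2) * (\<integral>\<^sup>+s. \<integral>\<^sup>+t. ennreal ((cmod (P (Complex s t)))\<^sup>2 + (cmod (Q (Complex s t)))\<^sup>2) *
      indicator L (Complex s t) \<partial>lborel \<partial>lborel)"
  proof (rule fiber_inequality[OF _ C_stat_nonneg \<Omega>(2) L])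
    show "2 * C_stat \<alpha> n \<le> cmod (cis (pi * \<alpha> * (2 * real p + 1)) - 1)"
      if "p \<le> card ({..<n} - {j, k})" for p
      using that unfolding c by (rule C_stat_le)
    show "\<bar>Re w\<bar> \<le> M \<and> \<bar>Im w\<bar> \<le> M" if "w \<in> L" for w
      using adm that by (simp add: L_def)
    show "v \<in> L" if "w \<in> L" "\<bar>Re v\<bar> \<le> \<bar>Re w\<bar>" "\<bar>Im v\<bar> \<le> \<bar>Im w\<bar>" for v w
    proof -
      have "X + frame e v \<in> \<Omega>" "X + frame e (- v) \<in> \<Omega>"
        using adm[of w] that unfolding L_def by auto
      then show ?thesis
        by (simp add: L_def frame_linear)
    qed
  qed
  have "(\<integral>\<^sup>+v. ennreal ((C_stat \<alpha> n)\<^sup>2) * (ennreal ((cmod (f (y(k := X - v, j := X + v))))\<^sup>2) *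
      indicator E (y(k := X - v, j := X + v))) \<partial>lborel) =
      (\<integral>\<^sup>+s. \<integral>\<^sup>+t. c * (ennreal ((C_stat \<alpha> n)\<^sup>2) * (ennreal ((cmod (f (conf (Complex s t))))\<^sup>2) * indicator L (Complex s t))) \<partial>lborel \<partial>lborel)"
    by (subst nn_integral_plane_frame[OF _ e], measurable)
      (simp only: fr conf_eq ind mult_ac)
  also have "\<dots> = c * (ennreal ((C_stat \<alpha> n)\<^sup>2) *
      (\<integral>\<^sup>+s. \<integral>\<^sup>+t. ennreal ((cmod (f (conf (Complex s t))))\<^sup>2) * indicator L (Complex s t) \<partial>lborel \<partial>lborel))"
    using L by (simp add: nn_integral_cmult)
  also have "\<dots> \<le> c * (ennreal (2 * M\<^sup>2) * (\<integral>\<^sup>+s. \<integral>\<^sup>+t. ennreal ((cmod (P (Complex s t)))\<^sup>2 + (cmod (Q (Complex s t)))\<^sup>2) *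
      indicator L (Complex s t) \<partial>lborel \<partial>lborel))"
    by (intro mult_left_mono fib) auto
  also have "\<dots> = (\<integral>\<^sup>+s. \<integral>\<^sup>+t. c * (ennreal (2 * M\<^sup>2) * (ennreal ((norm (cov_deriv n \<alpha> j f (conf (Complex s t)) -
      cov_deriv n \<alpha> k f (conf (Complex s t))))\<^sup>2) * indicator L (Complex s t))) \<partial>lborel \<partial>lborel)"
    unfolding norm_relative_cov_deriv using L by (simp add: nn_integral_cmult)
  also have "\<dots> = (\<integral>\<^sup>+v. ennreal (2 * M\<^sup>2) * (ennreal ((norm (cov_deriv n \<alpha> j f (y(k := X - v, j := X + v)) -
      cov_deriv n \<alpha> k f (y(k := X - v, j := X + v))))\<^sup>2) *
      indicator E (y(k := X - v, j := X + v))) \<partial>lborel)"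
    by (subst nn_integral_plane_frame[OF _ e], measurable)
      (simp only: fr conf_eq ind mult_ac)
  finally show ?thesis .
qed

text \<open>The fibre bound is applied for each \<open>y\<close> and \<open>X\<close> separately,
  with \<open>e\<close> chosen anew. How \<open>e\<close> varies with \<open>X\<close> is
  irrelevant, since both sides of the bound are free of \<open>e\<close>.\<close>

lemma pair_inequality:
  assumes f: "smooth n f" "symmetric n f" and jk: "j < n" "k < n" "j \<noteq> k"
    and \<Omega>: "admissible M \<Omega>"
  defines "E \<equiv> {..<n} \<rightarrow>\<^sub>E \<Omega>"
  shows "ennreal ((C_stat \<alpha> n)\<^sup>2) * (\<integral>\<^sup>+x. ennreal ((cmod (f x))\<^sup>2) * indicator E x \<partial>config_measure n) \<le>
    ennreal (2 * M\<^sup>2) *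
      (\<integral>\<^sup>+x. ennreal ((norm (cov_deriv n \<alpha> j f x - cov_deriv n \<alpha> k f x))\<^sup>2) * indicator E x \<partial>config_measure n)"
proof -
  have [measurable]: "f \<in> borel_measurable (config_measure n)"
    by (intro measurable_config_continuous smooth_continuous f)
  have [measurable]: "cov_deriv n \<alpha> j f \<in> borel_measurable (config_measure n)"
    "cov_deriv n \<alpha> k f \<in> borel_measurable (config_measure n)"
    by (intro measurable_cov_deriv f jk)+
  have [measurable]: "E \<in> sets (config_measure n)"
    unfolding E_def config_measure_def using \<Omega> by (intro sets_PiM_I_finite) (auto simp: admissible_def)
  have m1: "(\<lambda>x. ennreal ((C_stat \<alpha> n)\<^sup>2) * (ennreal ((cmod (f x))\<^sup>2) * indicator E x))
      \<in> borel_measurable (config_measure n)"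
    by measurable
  have m2: "(\<lambda>x. ennreal (2 * M\<^sup>2) *
      (ennreal ((norm (cov_deriv n \<alpha> j f x - cov_deriv n \<alpha> k f x))\<^sup>2) * indicator E x))
      \<in> borel_measurable (config_measure n)"
    by measurable
  have "ennreal ((C_stat \<alpha> n)\<^sup>2) * (\<integral>\<^sup>+x. ennreal ((cmod (f x))\<^sup>2) * indicator E x \<partial>config_measure n) =
      (\<integral>\<^sup>+x. ennreal ((C_stat \<alpha> n)\<^sup>2) * (ennreal ((cmod (f x))\<^sup>2) * indicator E x) \<partial>config_measure n)"
    by (rule nn_integral_cmult[symmetric]) measurable
  also have "\<dots> \<le> (\<integral>\<^sup>+x. ennreal (2 * M\<^sup>2) *
      (ennreal ((norm (cov_deriv n \<alpha> j f x - cov_deriv n \<alpha> k f x))\<^sup>2) * indicator E x) \<partial>config_measure n)"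
    unfolding nn_integral_config_pair[OF jk m1] nn_integral_config_pair[OF jk m2]
  proof (rule nn_integral_mono, rule mult_left_mono, rule nn_integral_mono)
    fix y :: config and X :: "real ^ 2"
    assume "y \<in> space (Pi\<^sub>M ({..<n} - {j, k}) (\<lambda>_. lborel :: (real ^ 2) measure))"
    then have y: "y \<in> ({..<n} - {j, k}) \<rightarrow>\<^sub>E UNIV"
      by (simp add: space_PiM)
    obtain e where e: "norm e = 1" and adm: "\<And>w. X + frame e w \<in> \<Omega> \<Longrightarrow> X - frame e w \<in> \<Omega> \<Longrightarrow>
       \<bar>Re w\<bar> \<le> M \<and> \<bar>Im w\<bar> \<le> M \<and>
       (\<forall>v. \<bar>Re v\<bar> \<le> \<bar>Re w\<bar> \<longrightarrow> \<bar>Im v\<bar> \<le> \<bar>Im w\<bar> \<longrightarrow> X + frame e v \<in> \<Omega>)"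
      using \<Omega> unfolding admissible_def by meson
    interpret pair_fiber n j k \<alpha> f y X e
      using f jk y e by unfold_locales
    show "(\<integral>\<^sup>+v. ennreal ((C_stat \<alpha> n)\<^sup>2) * (ennreal ((cmod (f (y(k := X - v, j := X + v))))\<^sup>2) *
        indicator E (y(k := X - v, j := X + v))) \<partial>lborel) \<le>
      (\<integral>\<^sup>+v. ennreal (2 * M\<^sup>2) * (ennreal ((norm (cov_deriv n \<alpha> j f (y(k := X - v, j := X + v)) -
        cov_deriv n \<alpha> k f (y(k := X - v, j := X + v))))\<^sup>2) *
        indicator E (y(k := X - v, j := X + v))) \<partial>lborel)"
      using \<Omega> unfolding E_def by (intro fiber_bound adm) (auto simp: admissible_def)
  qed auto
  also have "\<dots> = ennreal (2 * M\<^sup>2) *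
      (\<integral>\<^sup>+x. ennreal ((norm (cov_deriv n \<alpha> j f x - cov_deriv n \<alpha> k f x))\<^sup>2) * indicator E x \<partial>config_measure n)"
    by (rule nn_integral_cmult) measurable
  finally show ?thesis .
qed

section \<open>From pairs to the quadratic form\<close>

text \<open>Expanding the squares gives the right-hand side minus twice the squared norm of the sum
  of all \<open>x j\<close>, which is the centre-of-mass part.\<close>

lemma sum_pairwise_dist_sq_le:
  fixes x :: "'i \<Rightarrow> 'a::real_inner"
  assumes "finite A"
  shows "(\<Sum>j\<in>A. \<Sum>k\<in>A. (norm (x j - x k))\<^sup>2) \<le> 2 * real (card A) * (\<Sum>j\<in>A. (norm (x j))\<^sup>2)"
proof -
  have "(\<Sum>j\<in>A. \<Sum>k\<in>A. (norm (x j - x k))\<^sup>2) =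
      (\<Sum>j\<in>A. \<Sum>k\<in>A. (norm (x j))\<^sup>2 + (norm (x k))\<^sup>2 - 2 * (x j \<bullet> x k))"
    by (intro sum.cong refl) (simp add: power2_norm_eq_inner inner_diff_left inner_diff_right inner_commute)
  also have "\<dots> = 2 * real (card A) * (\<Sum>j\<in>A. (norm (x j))\<^sup>2) - 2 * ((\<Sum>j\<in>A. x j) \<bullet> (\<Sum>k\<in>A. x k))"
    by (simp add: sum.distrib sum_subtractf inner_sum_left inner_sum_right sum_distrib_left[symmetric])
      (rule sum.swap)
  also have "\<dots> \<le> 2 * real (card A) * (\<Sum>j\<in>A. (norm (x j))\<^sup>2)"
    by simp
  finally show ?thesis .
qed

text \<open>The pair bound is summed over the \<open>n * (n - 1)\<close> ordered pairs, whose
  energies total at most \<open>2 * n\<close> times the form. Cancelling \<open>n\<close> leaves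
  \<open>n - 1\<close> on the left and doubles \<open>2 * M^2\<close>. The cancellation is valid in
  \<open>ennreal\<close> even if the integrals are infinite, because \<open>n\<close> is neither 0
  nor \<open>top\<close>.\<close>

lemma core_inequality:
  assumes n: "2 \<le> n" and f: "smooth n f" "symmetric n f" and \<Omega>: "admissible M \<Omega>"
  defines "E \<equiv> {..<n} \<rightarrow>\<^sub>E \<Omega>"
  shows "ennreal ((real n - 1) * (C_stat \<alpha> n)\<^sup>2) * (\<integral>\<^sup>+x. ennreal ((cmod (f x))\<^sup>2) * indicator E x \<partial>config_measure n) \<le>
    ennreal (4 * M\<^sup>2) * (\<integral>\<^sup>+x. ennreal (\<Sum>j<n. (norm (cov_deriv n \<alpha> j f x))\<^sup>2) * indicator E x \<partial>config_measure n)"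
proof -
  define a where "a = (\<integral>\<^sup>+x. ennreal ((cmod (f x))\<^sup>2) * indicator E x \<partial>config_measure n)"
  define T where "T = (\<integral>\<^sup>+x. ennreal (\<Sum>j<n. (norm (cov_deriv n \<alpha> j f x))\<^sup>2) * indicator E x \<partial>config_measure n)"
  define d where "d j k = (\<integral>\<^sup>+x. ennreal ((norm (cov_deriv n \<alpha> j f x - cov_deriv n \<alpha> k f x))\<^sup>2) * indicator E x \<partial>config_measure n)" for j k
  have D: "cov_deriv n \<alpha> j f \<in> borel_measurable (config_measure n)" if "j < n" for j
    by (intro measurable_cov_deriv f that)
  have [measurable]: "E \<in> sets (config_measure n)"
    unfolding E_def config_measure_def using \<Omega> by (intro sets_PiM_I_finite) (auto simp: admissible_def)
  have m: "(\<lambda>x. ennreal ((norm (cov_deriv n \<alpha> j f x - cov_deriv n \<alpha> k f x))\<^sup>2) * indicator E x)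
      \<in> borel_measurable (config_measure n)" if "j < n" "k < n" for j k
  proof -
    note [measurable] = D[OF that(1)] D[OF that(2)]
    show ?thesis
      by measurable
  qed
  have mT: "(\<lambda>x. ennreal (\<Sum>j<n. (norm (cov_deriv n \<alpha> j f x))\<^sup>2) * indicator E x) \<in> borel_measurable (config_measure n)"
  proof -
    have "(\<lambda>x. \<Sum>j<n. (norm (cov_deriv n \<alpha> j f x))\<^sup>2) \<in> borel_measurable (config_measure n)"
      using D by (intro borel_measurable_sum borel_measurable_power borel_measurable_norm) auto
    then show ?thesis
      by measurable
  qed
  have sum_d: "(\<Sum>j<n. \<Sum>k<n. d j k) =
      (\<integral>\<^sup>+x. (\<Sum>j<n. \<Sum>k<n. ennreal ((norm (cov_deriv n \<alpha> j f x - cov_deriv n \<alpha> k f x))\<^sup>2) * indicator E x) \<partial>config_measure n)"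
    unfolding d_def
    by (subst nn_integral_sum, (intro borel_measurable_sum m; simp),
        intro sum.cong refl nn_integral_sum[symmetric] m) auto
  have "of_nat n * (ennreal ((real n - 1) * (C_stat \<alpha> n)\<^sup>2) * a) =
      (\<Sum>j<n. \<Sum>k\<in>{..<n} - {j}. ennreal ((C_stat \<alpha> n)\<^sup>2) * a)"
  proof -
    have "ennreal ((real n - 1) * (C_stat \<alpha> n)\<^sup>2) = of_nat (n - 1) * ennreal ((C_stat \<alpha> n)\<^sup>2)"
      using n by (simp add: ennreal_mult of_nat_diff flip: ennreal_of_nat_eq_real_of_nat)
        (simp add: ennreal_of_nat_eq_real_of_nat of_nat_diff flip: ennreal_mult)
    then show ?thesis
      by (simp add: mult.assoc)
  qed
  also have "\<dots> \<le> (\<Sum>j<n. \<Sum>k\<in>{..<n} - {j}. ennreal (2 * M\<^sup>2) * d j k)"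
    unfolding a_def d_def E_def by (intro sum_mono pair_inequality f \<Omega>) auto
  also have "\<dots> \<le> (\<Sum>j<n. \<Sum>k<n. ennreal (2 * M\<^sup>2) * d j k)"
    by (intro sum_mono sum_mono2) auto
  also have "\<dots> = ennreal (2 * M\<^sup>2) * (\<Sum>j<n. \<Sum>k<n. d j k)"
    by (simp add: sum_distrib_left)
  also have "\<dots> = ennreal (2 * M\<^sup>2) *
      (\<integral>\<^sup>+x. (\<Sum>j<n. \<Sum>k<n. ennreal ((norm (cov_deriv n \<alpha> j f x - cov_deriv n \<alpha> k f x))\<^sup>2) * indicator E x) \<partial>config_measure n)"
    by (simp only: sum_d)
  also have "\<dots> \<le> ennreal (2 * M\<^sup>2) * (\<integral>\<^sup>+x. ennreal (2 * real n) * (ennreal (\<Sum>j<n. (norm (cov_deriv n \<alpha> j f x))\<^sup>2) * indicator E x) \<partial>config_measure n)"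
  proof (intro mult_left_mono nn_integral_mono)
    fix x
    have "(\<Sum>j<n. \<Sum>k<n. ennreal ((norm (cov_deriv n \<alpha> j f x - cov_deriv n \<alpha> k f x))\<^sup>2)) =
        ennreal (\<Sum>j<n. \<Sum>k<n. (norm (cov_deriv n \<alpha> j f x - cov_deriv n \<alpha> k f x))\<^sup>2)"
      by (simp add: sum_nonneg)
    also have "\<dots> \<le> ennreal (2 * real n * (\<Sum>j<n. (norm (cov_deriv n \<alpha> j f x))\<^sup>2))"
      using sum_pairwise_dist_sq_le[of "{..<n}" "\<lambda>j. cov_deriv n \<alpha> j f x"] by (intro ennreal_leI) simp
    also have "\<dots> = ennreal (2 * real n) * ennreal (\<Sum>j<n. (norm (cov_deriv n \<alpha> j f x))\<^sup>2)"
      by (rule ennreal_mult) (auto simp: sum_nonneg)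
    finally show "(\<Sum>j<n. \<Sum>k<n. ennreal ((norm (cov_deriv n \<alpha> j f x - cov_deriv n \<alpha> k f x))\<^sup>2) * indicator E x) \<le>
        ennreal (2 * real n) * (ennreal (\<Sum>j<n. (norm (cov_deriv n \<alpha> j f x))\<^sup>2) * indicator E x)"
      by (auto simp: indicator_def)
  qed auto
  also have "\<dots> = ennreal (2 * M\<^sup>2) * (ennreal (2 * real n) * T)"
    unfolding T_def by (subst nn_integral_cmult[OF mT]) rule
  also have "\<dots> = of_nat n * (ennreal (4 * M\<^sup>2) * T)"
  proof -
    have "ennreal (2 * M\<^sup>2) * ennreal (2 * real n) = of_nat n * ennreal (4 * M\<^sup>2)"
      unfolding ennreal_of_nat_eq_real_of_nat by (simp flip: ennreal_mult)
    then show ?thesis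
      by (simp add: mult.assoc[symmetric])
  qed
  finally have "of_nat n * (ennreal ((real n - 1) * (C_stat \<alpha> n)\<^sup>2) * a) \<le> of_nat n * (ennreal (4 * M\<^sup>2) * T)" .
  moreover have "(of_nat n :: ennreal) \<noteq> 0" "(of_nat n :: ennreal) \<noteq> top"
    using n by auto
  ultimately show ?thesis
    unfolding a_def[symmetric] T_def[symmetric] by (rule ennreal_mult_le_mult_iff[THEN iffD1, rotated 2])
qed

section \<open>Passage from the form core to the form domain\<close>

lemma norm_sq_le_perturbed:
  fixes x y :: "'a::real_normed_vector"
  assumes "0 < \<epsilon>"
  shows "(norm x)\<^sup>2 \<le> (1 + \<epsilon>) * (norm y)\<^sup>2 + (1 + 1 / \<epsilon>) * (norm (x - y))\<^sup>2"
proof -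
  define p q where "p = norm y" and "q = norm (x - y)"
  have "norm x \<le> p + q"
    unfolding p_def q_def using norm_triangle_ineq[of y "x - y"] by simp
  then have "(norm x)\<^sup>2 \<le> (p + q)\<^sup>2"
    by (intro power_mono) auto
  moreover have "2 * p * q \<le> \<epsilon> * p\<^sup>2 + q\<^sup>2 / \<epsilon>"
  proof -
    have "0 \<le> (\<epsilon> * p - q)\<^sup>2 / \<epsilon>"
      using assms by simp
    also have "\<dots> = \<epsilon> * p\<^sup>2 + q\<^sup>2 / \<epsilon> - 2 * p * q"
      using assms by (simp add: power2_eq_square field_simps)
    finally show ?thesis
      by simp
  qed
  ultimately show ?thesis
    unfolding p_def[symmetric] q_def[symmetric] by (simp add: power2_sum algebra_simps)
qed

text \<open>A weighted triangle inequality: \<open>h\<close> keeps a weight close to 1 on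
  \<open>E\<close>, while the large weight falls on the global error, which tends to 0 in the
  application.\<close>

lemma nn_integral_norm_sq_perturbed:
  fixes g h :: "'a \<Rightarrow> 'b::{real_normed_vector, second_countable_topology}"
  assumes [measurable]: "g \<in> borel_measurable M" "h \<in> borel_measurable M" "E \<in> sets M" and \<epsilon>: "0 < \<epsilon>"
  shows "(\<integral>\<^sup>+x. ennreal ((norm (g x))\<^sup>2) * indicator E x \<partial>M) \<le>
    ennreal (1 + \<epsilon>) * (\<integral>\<^sup>+x. ennreal ((norm (h x))\<^sup>2) * indicator E x \<partial>M) +
    ennreal (1 + 1 / \<epsilon>) * (\<integral>\<^sup>+x. ennreal ((norm (g x - h x))\<^sup>2) \<partial>M)"
proof -
  have "(\<integral>\<^sup>+x. ennreal ((norm (g x))\<^sup>2) * indicator E x \<partial>M) \<le>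
    (\<integral>\<^sup>+x. ennreal (1 + \<epsilon>) * (ennreal ((norm (h x))\<^sup>2) * indicator E x) + ennreal (1 + 1 / \<epsilon>) * ennreal ((norm (g x - h x))\<^sup>2) \<partial>M)"
  proof (rule nn_integral_mono)
    fix x
    have "ennreal ((norm (g x))\<^sup>2) \<le> ennreal ((1 + \<epsilon>) * (norm (h x))\<^sup>2 + (1 + 1 / \<epsilon>) * (norm (g x - h x))\<^sup>2)"
      by (intro ennreal_leI norm_sq_le_perturbed \<epsilon>)
    also have "\<dots> = ennreal (1 + \<epsilon>) * ennreal ((norm (h x))\<^sup>2) + ennreal (1 + 1 / \<epsilon>) * ennreal ((norm (g x - h x))\<^sup>2)"
      using \<epsilon> by (simp add: ennreal_mult)
    finally show "ennreal ((norm (g x))\<^sup>2) * indicator E x \<le>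
        ennreal (1 + \<epsilon>) * (ennreal ((norm (h x))\<^sup>2) * indicator E x) + ennreal (1 + 1 / \<epsilon>) * ennreal ((norm (g x - h x))\<^sup>2)"
      by (auto simp: indicator_def)
  qed
  also have "\<dots> = ennreal (1 + \<epsilon>) * (\<integral>\<^sup>+x. ennreal ((norm (h x))\<^sup>2) * indicator E x \<partial>M) +
    ennreal (1 + 1 / \<epsilon>) * (\<integral>\<^sup>+x. ennreal ((norm (g x - h x))\<^sup>2) \<partial>M)"
    by (simp add: nn_integral_add nn_integral_cmult)
  finally show ?thesis .
qed

lemma L2_nn_integral:
  assumes "g \<in> L2 M" "E \<in> sets M"
  shows "integrable M (\<lambda>x. indicator E x *\<^sub>R (norm (g x))\<^sup>2)"
    and "(\<integral>\<^sup>+x. ennreal ((norm (g x))\<^sup>2) * indicator E x \<partial>M) = ennreal (LINT x:E|M. (norm (g x))\<^sup>2)"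
proof -
  show i: "integrable M (\<lambda>x. indicator E x *\<^sub>R (norm (g x))\<^sup>2)"
    using assms unfolding L2_def by (intro integrable_mult_indicator) auto
  have "(\<integral>\<^sup>+x. ennreal ((norm (g x))\<^sup>2) * indicator E x \<partial>M) = (\<integral>\<^sup>+x. ennreal (indicator E x *\<^sub>R (norm (g x))\<^sup>2) \<partial>M)"
    by (intro nn_integral_cong) (auto simp: indicator_def)
  also have "\<dots> = ennreal (LINT x:E|M. (norm (g x))\<^sup>2)"
    unfolding set_lebesgue_integral_def by (intro nn_integral_eq_integral i) auto
  finally show "(\<integral>\<^sup>+x. ennreal ((norm (g x))\<^sup>2) * indicator E x \<partial>M) = ennreal (LINT x:E|M. (norm (g x))\<^sup>2)" .
qed

text \<open>The core bound for the approximants belonging to \<open>Du\<close> is perturbed twice,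
  from \<open>u\<close> to \<open>\<phi> k\<close> and from the covariant derivatives of
  \<open>\<phi> k\<close> to \<open>Du\<close>, whence the factor \<open>(1 + \<epsilon>)^2\<close>.
  At fixed \<open>\<epsilon>\<close> the errors vanish as \<open>k\<close> grows; afterwards
  \<open>\<epsilon>\<close> tends to 0.\<close>

lemma form_domain_inequality:
  assumes n: "2 \<le> n" and u: "u \<in> form_domain n \<alpha>" and Du: "is_cov_deriv_limit n \<alpha> u Du"
    and \<Omega>: "admissible M \<Omega>"
  defines "E \<equiv> {..<n} \<rightarrow>\<^sub>E \<Omega>"
  shows "(real n - 1) * (C_stat \<alpha> n)\<^sup>2 * (LINT x:E|config_measure n. (norm (u x))\<^sup>2) \<le>
    4 * M\<^sup>2 * (LINT x:E|config_measure n. (\<Sum>j<n. (norm (Du j x))\<^sup>2))"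
proof -
  let ?\<mu> = "config_measure n"
  have uL: "u \<in> L2 ?\<mu>"
    using u by (simp add: form_domain_def L2_sym_def)
  have DuL: "Du j \<in> L2 ?\<mu>" if "j < n" for j
    using Du that by (simp add: is_cov_deriv_limit_def)
  obtain \<phi> where \<phi>: "\<And>k. \<phi> k \<in> form_core n" and lim: "L2_tendsto ?\<mu> \<phi> u"
    and Dlim: "\<And>j. j < n \<Longrightarrow> L2_tendsto ?\<mu> (\<lambda>k. cov_deriv n \<alpha> j (\<phi> k)) (Du j)"
    using Du unfolding is_cov_deriv_limit_def by blast
  have sm: "smooth n (\<phi> k)" and sy: "symmetric n (\<phi> k)" for k
    using \<phi>[of k] by (auto simp: form_core_def symmetric_def)
  have [measurable]: "E \<in> sets ?\<mu>"
    unfolding E_def config_measure_def using \<Omega> by (intro sets_PiM_I_finite) (auto simp: admissible_def)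
  have [measurable]: "u \<in> borel_measurable ?\<mu>" "\<phi> k \<in> borel_measurable ?\<mu>" for k
    using uL by (auto simp: L2_def intro!: measurable_config_continuous smooth_continuous sm)
  have mD: "Du j \<in> borel_measurable ?\<mu>" "cov_deriv n \<alpha> j (\<phi> k) \<in> borel_measurable ?\<mu>" if "j < n" for j k
    using DuL[OF that] by (auto simp: L2_def intro!: measurable_cov_deriv sm that)
  define c where "c = (real n - 1) * (C_stat \<alpha> n)\<^sup>2"
  define a where "a = (LINT x:E|?\<mu>. (norm (u x))\<^sup>2)"
  define T where "T = (LINT x:E|?\<mu>. (\<Sum>j<n. (norm (Du j x))\<^sup>2))"
  define \<delta> where "\<delta> k = (\<integral>\<^sup>+x. ennreal ((norm (\<phi> k x - u x))\<^sup>2) \<partial>?\<mu>)" for k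
  define \<eta> where "\<eta> k = (\<Sum>j<n. \<integral>\<^sup>+x. ennreal ((norm (cov_deriv n \<alpha> j (\<phi> k) x - Du j x))\<^sup>2) \<partial>?\<mu>)" for k
  have \<delta>: "\<delta> \<longlonglongrightarrow> 0"
    using lim unfolding L2_tendsto_def \<delta>_def[abs_def] .
  have \<eta>: "\<eta> \<longlonglongrightarrow> 0"
    unfolding \<eta>_def[abs_def] using Dlim unfolding L2_tendsto_def by (intro tendsto_null_sum) auto
  have c0: "0 \<le> c"
    using n by (simp add: c_def)
  have a: "(\<integral>\<^sup>+x. ennreal ((norm (u x))\<^sup>2) * indicator E x \<partial>?\<mu>) = ennreal a"
    unfolding a_def by (intro L2_nn_integral uL) measurable
  have a0: "0 \<le> a" and T0: "0 \<le> T"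
    unfolding a_def T_def set_lebesgue_integral_def by (auto intro!: integral_nonneg_AE AE_I2 mult_nonneg_nonneg sum_nonneg)
  have T_eq: "T = (\<Sum>j<n. LINT x:E|?\<mu>. (norm (Du j x))\<^sup>2)"
    unfolding T_def set_lebesgue_integral_def scaleR_sum_right
    by (intro Bochner_Integration.integral_sum L2_nn_integral(1) DuL) auto
  have T: "(\<Sum>j<n. \<integral>\<^sup>+x. ennreal ((norm (Du j x))\<^sup>2) * indicator E x \<partial>?\<mu>) = ennreal T"
  proof -
    have "(\<Sum>j<n. \<integral>\<^sup>+x. ennreal ((norm (Du j x))\<^sup>2) * indicator E x \<partial>?\<mu>) =
        (\<Sum>j<n. ennreal (LINT x:E|?\<mu>. (norm (Du j x))\<^sup>2))"
      by (intro sum.cong refl L2_nn_integral DuL) auto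
    also have "\<dots> = ennreal T"
      unfolding T_eq by (intro sum_ennreal) (auto simp: set_lebesgue_integral_def intro!: integral_nonneg_AE)
    finally show ?thesis .
  qed
  have step: "c * a \<le> (1 + \<epsilon>)\<^sup>2 * (4 * M\<^sup>2 * T)" if \<epsilon>: "0 < \<epsilon>" for \<epsilon>
  proof -
    let ?K = "ennreal (1 + 1 / \<epsilon>)" and ?L = "ennreal (1 + \<epsilon>)"
    have bound: "ennreal c * ennreal a \<le>
        ?L * (ennreal (4 * M\<^sup>2) * (?L * ennreal T + ?K * \<eta> k)) + ennreal c * (?K * \<delta> k)" for k
    proof -
      have "ennreal a \<le> ?L * (\<integral>\<^sup>+x. ennreal ((norm (\<phi> k x))\<^sup>2) * indicator E x \<partial>?\<mu>) + ?K * \<delta> k"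
      proof -
        have "ennreal a \<le> ?L * (\<integral>\<^sup>+x. ennreal ((norm (\<phi> k x))\<^sup>2) * indicator E x \<partial>?\<mu>) +
            ?K * (\<integral>\<^sup>+x. ennreal ((norm (u x - \<phi> k x))\<^sup>2) \<partial>?\<mu>)"
          unfolding a[symmetric] by (rule nn_integral_norm_sq_perturbed[OF _ _ _ \<epsilon>]) measurable
        then show ?thesis
          by (simp add: \<delta>_def norm_minus_commute)
      qed
      then have "ennreal c * ennreal a \<le>
          ennreal c * (?L * (\<integral>\<^sup>+x. ennreal ((norm (\<phi> k x))\<^sup>2) * indicator E x \<partial>?\<mu>) + ?K * \<delta> k)"
        by (intro mult_left_mono) auto
      also have "\<dots> = ?L * (ennreal c * (\<integral>\<^sup>+x. ennreal ((norm (\<phi> k x))\<^sup>2) * indicator E x \<partial>?\<mu>)) + ennreal c * (?K * \<delta> k)"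
        by (simp add: distrib_left mult_ac)
      also have "\<dots> \<le> ?L * (ennreal (4 * M\<^sup>2) * (?L * ennreal T + ?K * \<eta> k)) + ennreal c * (?K * \<delta> k)"
      proof (intro add_right_mono mult_left_mono)
        have "ennreal c * (\<integral>\<^sup>+x. ennreal ((norm (\<phi> k x))\<^sup>2) * indicator E x \<partial>?\<mu>) \<le>
            ennreal (4 * M\<^sup>2) * (\<integral>\<^sup>+x. ennreal (\<Sum>j<n. (norm (cov_deriv n \<alpha> j (\<phi> k) x))\<^sup>2) * indicator E x \<partial>?\<mu>)"
          unfolding c_def E_def by (intro core_inequality n sm sy \<Omega>)
        also have "(\<integral>\<^sup>+x. ennreal (\<Sum>j<n. (norm (cov_deriv n \<alpha> j (\<phi> k) x))\<^sup>2) * indicator E x \<partial>?\<mu>) =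
            (\<integral>\<^sup>+x. (\<Sum>j<n. ennreal ((norm (cov_deriv n \<alpha> j (\<phi> k) x))\<^sup>2) * indicator E x) \<partial>?\<mu>)"
          by (intro nn_integral_cong) (simp add: sum_distrib_right[symmetric])
        also have "\<dots> = (\<Sum>j<n. \<integral>\<^sup>+x. ennreal ((norm (cov_deriv n \<alpha> j (\<phi> k) x))\<^sup>2) * indicator E x \<partial>?\<mu>)"
        proof (rule nn_integral_sum)
          fix j
          assume "j \<in> {..<n}"
          then have [measurable]: "cov_deriv n \<alpha> j (\<phi> k) \<in> borel_measurable ?\<mu>"
            by (intro mD) auto
          show "(\<lambda>x. ennreal ((norm (cov_deriv n \<alpha> j (\<phi> k) x))\<^sup>2) * indicator E x) \<in> borel_measurable ?\<mu>"
            by measurable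
        qed
        also have "\<dots> \<le> (\<Sum>j<n. ?L * (\<integral>\<^sup>+x. ennreal ((norm (Du j x))\<^sup>2) * indicator E x \<partial>?\<mu>) +
            ?K * (\<integral>\<^sup>+x. ennreal ((norm (cov_deriv n \<alpha> j (\<phi> k) x - Du j x))\<^sup>2) \<partial>?\<mu>))"
          by (intro sum_mono nn_integral_norm_sq_perturbed \<epsilon> mD) auto
        also have "\<dots> = ?L * ennreal T + ?K * \<eta> k"
          unfolding T[symmetric] \<eta>_def by (simp add: sum.distrib sum_distrib_left)
        finally show "ennreal c * (\<integral>\<^sup>+x. ennreal ((norm (\<phi> k x))\<^sup>2) * indicator E x \<partial>?\<mu>) \<le>
            ennreal (4 * M\<^sup>2) * (?L * ennreal T + ?K * \<eta> k)"
          by (simp add: mult_left_mono)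
      qed auto
      finally show ?thesis .
    qed
    have "(\<lambda>k. ?L * (ennreal (4 * M\<^sup>2) * (?L * ennreal T + ?K * \<eta> k)) + ennreal c * (?K * \<delta> k)) \<longlonglongrightarrow>
        ?L * (ennreal (4 * M\<^sup>2) * (?L * ennreal T + ?K * 0)) + ennreal c * (?K * 0)"
      by (intro tendsto_add ennreal_tendsto_cmult tendsto_const \<eta> \<delta>) auto
    then have "ennreal c * ennreal a \<le> ?L * (ennreal (4 * M\<^sup>2) * (?L * ennreal T + ?K * 0)) + ennreal c * (?K * 0)"
      by (rule LIMSEQ_le_const) (use bound in auto)
    also have "\<dots> = ennreal ((1 + \<epsilon>) * (4 * M\<^sup>2 * ((1 + \<epsilon>) * T)))"
      using \<epsilon> T0 by (simp add: ennreal_mult del: ennreal_plus)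
    also have "(1 + \<epsilon>) * (4 * M\<^sup>2 * ((1 + \<epsilon>) * T)) = (1 + \<epsilon>)\<^sup>2 * (4 * M\<^sup>2 * T)"
      by (simp add: power2_eq_square)
    finally have "ennreal (c * a) \<le> ennreal ((1 + \<epsilon>)\<^sup>2 * (4 * M\<^sup>2 * T))"
      using c0 a0 by (simp add: ennreal_mult)
    then show ?thesis
      using T0 by (subst (asm) ennreal_le_iff) auto
  qed
  have "(\<lambda>m. (1 + 1 / real (Suc m))\<^sup>2 * (4 * M\<^sup>2 * T)) \<longlonglongrightarrow> (1 + 0)\<^sup>2 * (4 * M\<^sup>2 * T)"
    by (intro tendsto_intros LIMSEQ_Suc lim_1_over_n)
  then have "c * a \<le> (1 + 0)\<^sup>2 * (4 * M\<^sup>2 * T)"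
    by (rule LIMSEQ_le_const) (use step in auto)
  then show ?thesis
    by (simp add: c_def a_def T_def)
qed

section \<open>Disks and squares\<close>

text \<open>With the first axis pointing from \<open>c\<close> to \<open>X\<close>, the points of
  the rectangle farthest from \<open>c\<close> are the two corners at first coordinate
  \<open>d + |Re w|\<close>. They are mirror images in that axis, hence equally far from
  \<open>c\<close>, and one of them is \<open>X + w\<close> or \<open>X - w\<close>, which lies in
  the disk.\<close>

lemma admissible_disk:
  assumes R: "0 < R" and \<Omega>: "\<Omega> = ball c R \<or> \<Omega> = cball c R"
  shows "admissible R \<Omega>"
proof -
  define inside where "inside r \<longleftrightarrow> (if \<Omega> = ball c R then r < R else r \<le> R)" for r
  have mem: "x \<in> \<Omega> \<longleftrightarrow> inside (norm (x - c))" for x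
    using \<Omega> by (auto simp: inside_def dist_norm norm_minus_commute)
  have inside: "inside r" if "inside r'" "r \<le> r'" for r r'
    using that by (auto simp: inside_def split: if_splits)
  have le: "r \<le> R" if "inside r" for r
    using that by (auto simp: inside_def split: if_splits)
  have "\<exists>e. norm e = 1 \<and> (\<forall>w. X + frame e w \<in> \<Omega> \<longrightarrow> X - frame e w \<in> \<Omega> \<longrightarrow>
       \<bar>Re w\<bar> \<le> R \<and> \<bar>Im w\<bar> \<le> R \<and>
       (\<forall>v. \<bar>Re v\<bar> \<le> \<bar>Re w\<bar> \<longrightarrow> \<bar>Im v\<bar> \<le> \<bar>Im w\<bar> \<longrightarrow> X + frame e v \<in> \<Omega>))" for X
  proof -
    define d where "d = norm (X - c)"
    \<comment> \<open>If \<open>X\<close> is the centre of the disk there is no preferred direction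
      and any unit vector serves.\<close>
    define e :: "real ^ 2" where "e = (if X = c then axis 1 1 else (X - c) /\<^sub>R d)"
    have e: "norm e = 1"
      by (auto simp: e_def d_def norm_axis_1)
    have d: "0 \<le> d" and X: "X - c = frame e (of_real d)"
      by (auto simp: e_def d_def frame_def)
    have nrm: "norm (X + frame e w - c) = cmod (of_real d + w)" for w
    proof -
      have "X + frame e w - c = frame e (of_real d + w)"
        unfolding frame_linear X[symmetric] by simp
      then show ?thesis
        by (simp only: norm_frame[OF e])
    qed
    have mono: "cmod (of_real d + v) \<le> cmod (Complex (d + r) s)"
      if "\<bar>Re v\<bar> \<le> r" "\<bar>Im v\<bar> \<le> \<bar>s\<bar>" for v r s
    proof -
      have "(d + Re v)\<^sup>2 \<le> (d + r)\<^sup>2"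
        using that d by (intro abs_le_square_iff[THEN iffD1]) auto
      moreover have "(Im v)\<^sup>2 \<le> s\<^sup>2"
        using that by (intro abs_le_square_iff[THEN iffD1])
      ultimately show ?thesis
        by (simp add: cmod_def)
    qed
    show ?thesis
    proof (intro exI[of _ e] conjI allI impI e)
      fix w
      assume w: "X + frame e w \<in> \<Omega>" "X - frame e w \<in> \<Omega>"
      have ins: "inside (cmod (Complex (d + \<bar>Re w\<bar>) (Im w)))"
      proof (cases "0 \<le> Re w")
        case True
        then have "Complex (d + \<bar>Re w\<bar>) (Im w) = of_real d + w"
          by (simp add: complex_eq_iff)
        then show ?thesis
          using w(1) by (simp only: mem nrm)
      next
        case False
        have "cmod (Complex (d + \<bar>Re w\<bar>) (Im w)) = cmod (of_real d + - w)"
          using False by (simp add: cmod_def)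
        then show ?thesis
          using w(2) nrm[of "- w"] by (simp add: mem frame_linear)
      qed
      have "\<bar>Re (Complex (d + \<bar>Re w\<bar>) (Im w))\<bar> \<le> R" "\<bar>Im (Complex (d + \<bar>Re w\<bar>) (Im w))\<bar> \<le> R"
        using le[OF ins] abs_Re_le_cmod abs_Im_le_cmod order_trans by blast+
      then show "\<bar>Re w\<bar> \<le> R" "\<bar>Im w\<bar> \<le> R"
        using d by auto
      fix v
      assume "\<bar>Re v\<bar> \<le> \<bar>Re w\<bar>" "\<bar>Im v\<bar> \<le> \<bar>Im w\<bar>"
      then show "X + frame e v \<in> \<Omega>"
        unfolding mem nrm by (intro inside[OF ins] mono)
    qed
  qed
  moreover have "\<Omega> \<in> sets borel"
    using \<Omega> by auto
  ultimately show ?thesis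
    using R by (simp add: admissible_def)
qed

lemma measure_disk:
  fixes c :: "real ^ 2"
  assumes "0 < R" "\<Omega> = ball c R \<or> \<Omega> = cball c R"
  shows "measure lborel \<Omega> = pi * R\<^sup>2"
  using assms content_ball[of R c] content_cball[of R c] by (auto simp: unit_ball_vol_2)

text \<open>Leaving \<open>J\<close> arbitrary treats open and closed squares together;
  \<open>r\<close> is the side length.\<close>

lemma frame_square:
  fixes e\<^sub>0 c :: "real ^ 2"
  assumes e0: "e\<^sub>0 \<noteq> 0"
  defines "r \<equiv> norm e\<^sub>0"
  defines "e \<equiv> e\<^sub>0 /\<^sub>R r"
  shows "norm e = 1"
    and "c + frame e w \<in> {c + s *\<^sub>R e\<^sub>0 + t *\<^sub>R rot90 e\<^sub>0 | s t. s \<in> J \<and> t \<in> J} \<longleftrightarrow> Re w / r \<in> J \<and> Im w / r \<in> J"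
proof -
  have l: "0 < r"
    using e0 by (simp add: r_def)
  show e: "norm e = 1"
    using e0 by (simp add: e_def r_def)
  have fr: "c + s *\<^sub>R e\<^sub>0 + t *\<^sub>R rot90 e\<^sub>0 = c + frame e (of_real r * Complex s t)" for s t
    using l by (simp add: frame_def e_def rot90_scaleR flip: divide_inverse)
  have inj: "frame e v = frame e w \<longleftrightarrow> v = w" for v w
    using norm_frame[OF e, of "v - w"] by (auto simp: frame_linear)
  have "c + frame e w \<in> {c + s *\<^sub>R e\<^sub>0 + t *\<^sub>R rot90 e\<^sub>0 | s t. s \<in> J \<and> t \<in> J} \<longleftrightarrow>
      (\<exists>s\<in>J. \<exists>t\<in>J. w = of_real r * Complex s t)"
    unfolding fr by (auto simp: inj)
  also have "\<dots> \<longleftrightarrow> Re w / r \<in> J \<and> Im w / r \<in> J"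
  proof -
    have "w = of_real r * Complex s t \<longleftrightarrow> s = Re w / r \<and> t = Im w / r" for s t
      using l by (auto simp: complex_eq_iff field_simps)
    then show ?thesis
      by simp
  qed
  finally show "c + frame e w \<in> {c + s *\<^sub>R e\<^sub>0 + t *\<^sub>R rot90 e\<^sub>0 | s t. s \<in> J \<and> t \<in> J} \<longleftrightarrow> Re w / r \<in> J \<and> Im w / r \<in> J" .
qed

lemma sets_square:
  fixes e\<^sub>0 c :: "real ^ 2"
  assumes e0: "e\<^sub>0 \<noteq> 0" and [measurable]: "J \<in> sets borel"
  shows "{c + s *\<^sub>R e\<^sub>0 + t *\<^sub>R rot90 e\<^sub>0 | s t. s \<in> J \<and> t \<in> J} \<in> sets borel"
proof -
  let ?\<Omega> = "{c + s *\<^sub>R e\<^sub>0 + t *\<^sub>R rot90 e\<^sub>0 | s t. s \<in> J \<and> t \<in> J}"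
  define e where "e = e\<^sub>0 /\<^sub>R norm e\<^sub>0"
  have "?\<Omega> = {x. ((x - c) \<bullet> e) / norm e\<^sub>0 \<in> J \<and> ((x - c) \<bullet> rot90 e) / norm e\<^sub>0 \<in> J}"
  proof (intro set_eqI)
    fix x
    have "c + frame e (Complex ((x - c) \<bullet> e) ((x - c) \<bullet> rot90 e)) = x"
      using frame_square(1)[OF e0] unfolding e_def by (subst frame_surj) auto
    then show "x \<in> ?\<Omega> \<longleftrightarrow> x \<in> {x. ((x - c) \<bullet> e) / norm e\<^sub>0 \<in> J \<and> ((x - c) \<bullet> rot90 e) / norm e\<^sub>0 \<in> J}"
      using frame_square(2)[OF e0, of c "Complex ((x - c) \<bullet> e) ((x - c) \<bullet> rot90 e)" J]
      unfolding e_def[symmetric] by simp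
  qed
  also have "\<dots> \<in> sets borel"
    by measurable
  finally show ?thesis .
qed

text \<open>The axes of the square serve for every \<open>X\<close>, and the two coordinates
  decouple. In each it is a fact about an interval of length \<open>r\<close>: if it contains
  \<open>a + b\<close> and \<open>a - b\<close>, then \<open>|b| \<le> r / 2\<close> and everything
  between them is in it.\<close>

lemma admissible_square:
  fixes e\<^sub>0 c :: "real ^ 2"
  assumes e0: "e\<^sub>0 \<noteq> 0" and J: "J = {0<..<1} \<or> J = {0..1}"
  shows "admissible (norm e\<^sub>0 / 2) {c + s *\<^sub>R e\<^sub>0 + t *\<^sub>R rot90 e\<^sub>0 | s t. s \<in> J \<and> t \<in> J}" (is "admissible _ ?\<Omega>")
proof -
  define r where "r = norm e\<^sub>0"
  define e where "e = e\<^sub>0 /\<^sub>R r"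
  note fs = frame_square[OF e0, folded r_def, folded e_def]
  have l: "0 < r"
    using e0 by (simp add: r_def)
  have half: "\<bar>b\<bar> * 2 \<le> r" if "(a + b) / r \<in> J" "(a - b) / r \<in> J" for a b
  proof -
    have "0 \<le> a + b" "a + b \<le> r" "0 \<le> a - b" "a - b \<le> r"
      using that J l by (auto simp: field_simps)
    then show ?thesis
      by linarith
  qed
  have shrink: "(a + b') / r \<in> J" if "(a + b) / r \<in> J" "(a - b) / r \<in> J" "\<bar>b'\<bar> \<le> \<bar>b\<bar>" for a b b'
  proof -
    have "min (a + b) (a - b) \<le> a + b'" "a + b' \<le> max (a + b) (a - b)"
      using that(3) by linarith+
    with that(1,2) J l show ?thesis
      by (auto simp: field_simps min_def max_def split: if_splits)
  qed
  have "\<exists>e. norm e = 1 \<and> (\<forall>w. X + frame e w \<in> ?\<Omega> \<longrightarrow> X - frame e w \<in> ?\<Omega> \<longrightarrow>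
       \<bar>Re w\<bar> \<le> r / 2 \<and> \<bar>Im w\<bar> \<le> r / 2 \<and>
       (\<forall>v. \<bar>Re v\<bar> \<le> \<bar>Re w\<bar> \<longrightarrow> \<bar>Im v\<bar> \<le> \<bar>Im w\<bar> \<longrightarrow> X + frame e v \<in> ?\<Omega>))" for X
  proof -
    define x where "x = Complex ((X - c) \<bullet> e) ((X - c) \<bullet> rot90 e)"
    have "frame e x = X - c"
      unfolding x_def by (rule frame_surj[OF fs(1)])
    then have X: "X + frame e w = c + frame e (x + w)" "X - frame e w = c + frame e (x - w)" for w
      by (simp_all add: frame_linear)
    have mem: "X + frame e w \<in> ?\<Omega> \<longleftrightarrow> (Re x + Re w) / r \<in> J \<and> (Im x + Im w) / r \<in> J"
      "X - frame e w \<in> ?\<Omega> \<longleftrightarrow> (Re x - Re w) / r \<in> J \<and> (Im x - Im w) / r \<in> J" for w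
      unfolding X fs(2) by simp_all
    show ?thesis
      unfolding mem by (intro exI[of _ e] conjI fs(1)) (unfold mem, auto intro: half shrink)
  qed
  moreover have "?\<Omega> \<in> sets borel"
    using J by (intro sets_square e0) auto
  ultimately show ?thesis
    using l unfolding admissible_def r_def by simp
qed

text \<open>By rotation invariance the area can be computed in the frame of the square, where its
  indicator is a product.\<close>

lemma measure_square:
  fixes e\<^sub>0 c :: "real ^ 2"
  assumes e0: "e\<^sub>0 \<noteq> 0" and J: "J = {0<..<1} \<or> J = {0..1}"
  shows "measure lborel {c + s *\<^sub>R e\<^sub>0 + t *\<^sub>R rot90 e\<^sub>0 | s t. s \<in> J \<and> t \<in> J} = (norm e\<^sub>0)\<^sup>2" (is "measure _ ?\<Omega> = _")
proof -
  define r where "r = norm e\<^sub>0"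
  define e where "e = e\<^sub>0 /\<^sub>R r"
  note fs = frame_square[OF e0, folded r_def, folded e_def]
  have l: "0 < r"
    using e0 by (simp add: r_def)
  have [measurable]: "?\<Omega> \<in> sets borel" "J \<in> sets borel"
    using J by (auto intro!: sets_square e0)
  have ind: "indicator ?\<Omega> (c + (s *\<^sub>R e + t *\<^sub>R rot90 e)) = (indicator J (s / r) * indicator J (t / r) :: ennreal)" for s t
    using fs(2)[of c "Complex s t" J] by (auto simp: frame_def indicator_def)
  have len: "(\<integral>\<^sup>+s. indicator J (s / r) \<partial>lborel) = ennreal r"
    using l J by (subst nn_integral_real_affine[where c = r and t = 0]) auto
  have "emeasure lborel ?\<Omega> = (\<integral>\<^sup>+x. indicator ?\<Omega> x \<partial>lborel)"
    by simp
  also have "\<dots> = (\<integral>\<^sup>+x. indicator ?\<Omega> (c + x) \<partial>lborel)"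
    by (subst nn_integral_lborel_affine[where c = 1 and t = c]) auto
  also have "\<dots> = (\<integral>\<^sup>+s. \<integral>\<^sup>+t. indicator ?\<Omega> (c + (s *\<^sub>R e + t *\<^sub>R rot90 e)) \<partial>lborel \<partial>lborel)"
    by (rule nn_integral_plane_frame[OF _ fs(1)]) measurable
  also have "\<dots> = ennreal r * ennreal r"
    unfolding ind by (simp add: nn_integral_cmult nn_integral_multc len)
  also have "\<dots> = ennreal (r\<^sup>2)"
    using l by (simp add: power2_eq_square ennreal_mult)
  finally show ?thesis
    using l by (simp add: measure_def r_def)
qed

theorem lemma7:
  "\<exists>c_disk c_square :: real. c_disk \<ge> 0.169 \<and> c_square \<ge> 0.112 \<and>
     (\<forall>(n::nat) (\<alpha>::real) (u :: config \<Rightarrow> complex) (Du :: nat \<Rightarrow> config \<Rightarrow> complex ^ 2)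
        (\<Omega> :: (real ^ 2) set) (c_\<Omega> :: real).
        n \<ge> 2 \<longrightarrow> u \<in> form_domain n \<alpha> \<longrightarrow> is_cov_deriv_limit n \<alpha> u Du \<longrightarrow>
        (is_disk \<Omega> \<and> c_\<Omega> = c_disk \<or> is_square \<Omega> \<and> c_\<Omega> = c_square) \<longrightarrow>
        (LINT x:{..<n} \<rightarrow>\<^sub>E \<Omega>|config_measure n. (\<Sum>j<n. (norm (Du j x))\<^sup>2))
          \<ge> (real n - 1) * (c_\<Omega> * (C_stat \<alpha> n)\<^sup>2 / measure lborel \<Omega>)
             * (LINT x:{..<n} \<rightarrow>\<^sub>E \<Omega>|config_measure n. (norm (u x))\<^sup>2))"
proof (rule exI[of _ "pi / 4"], rule exI[of _ 1], intro conjI allI impI)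
  show "0.169 \<le> pi / 4"
    using pi_gt3 by simp
  show "0.112 \<le> (1 :: real)"
    by simp
  fix n :: nat and \<alpha> c_\<Omega> :: real and u :: "config \<Rightarrow> complex" and Du :: "nat \<Rightarrow> config \<Rightarrow> complex ^ 2"
    and \<Omega> :: "(real ^ 2) set"
  assume n: "2 \<le> n" and u: "u \<in> form_domain n \<alpha>" "is_cov_deriv_limit n \<alpha> u Du"
    and "is_disk \<Omega> \<and> c_\<Omega> = pi / 4 \<or> is_square \<Omega> \<and> c_\<Omega> = 1"
  \<comment> \<open>The origin of both constants: \<open>M = R\<close> gives
    \<open>pi * R^2 / (4 * R^2)\<close> for the disk, and half the side, \<open>M = r / 2\<close>,
    gives \<open>r^2 / (4 * (r / 2)^2)\<close> for the square.\<close>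
  then obtain M where M: "admissible M \<Omega>" "0 < M" "c_\<Omega> / measure lborel \<Omega> = 1 / (4 * M\<^sup>2)"
  proof (elim disjE conjE)
    assume "is_disk \<Omega>" and c: "c_\<Omega> = pi / 4"
    then obtain c R where R: "0 < R" "\<Omega> = ball c R \<or> \<Omega> = cball c R"
      by (auto simp: is_disk_def)
    show thesis
      by (rule that[OF admissible_disk[OF R] R(1)]) (simp add: c measure_disk[OF R])
  next
    assume "is_square \<Omega>" and c: "c_\<Omega> = 1"
    then obtain b e\<^sub>0 J where e0: "e\<^sub>0 \<noteq> 0" and J: "J = {0<..<1} \<or> J = {0..1}"
      and \<Omega>: "\<Omega> = {b + s *\<^sub>R e\<^sub>0 + t *\<^sub>R rot90 e\<^sub>0 | s t. s \<in> J \<and> t \<in> J}"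
      unfolding is_square_def by blast
    show thesis
      by (rule that[of "norm e\<^sub>0 / 2"], unfold \<Omega>)
        (use e0 in \<open>simp_all add: c measure_square[OF e0 J] admissible_square[OF e0 J] power_divide\<close>)
  qed
  define a where "a = (LINT x:{..<n} \<rightarrow>\<^sub>E \<Omega>|config_measure n. (norm (u x))\<^sup>2)"
  define T where "T = (LINT x:{..<n} \<rightarrow>\<^sub>E \<Omega>|config_measure n. (\<Sum>j<n. (norm (Du j x))\<^sup>2))"
  have "(real n - 1) * (C_stat \<alpha> n)\<^sup>2 * a \<le> 4 * M\<^sup>2 * T"
    unfolding a_def T_def by (rule form_domain_inequality[OF n u M(1)])
  then have "(real n - 1) * (C_stat \<alpha> n)\<^sup>2 * a / (4 * M\<^sup>2) \<le> T"
    using M(2) by (simp add: field_simps)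
  also have "(real n - 1) * (C_stat \<alpha> n)\<^sup>2 * a / (4 * M\<^sup>2) =
      (real n - 1) * (c_\<Omega> / measure lborel \<Omega> * (C_stat \<alpha> n)\<^sup>2) * a"
    unfolding M(3) by simp
  finally show "(real n - 1) * (c_\<Omega> * (C_stat \<alpha> n)\<^sup>2 / measure lborel \<Omega>) * a \<le> T"
    by simp
qed

end
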